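(* Every even Artin group whose defining graph is a triangle graph is poly-free.
   Context: Let $\Gamma$ be a finite simple graph with vertex set $V$ and edges labelled by integers $m_e\ge 2$. The Artin group is $A_\Gamma=\langle V \mid {}_{m_e}(uv)={}_{m_e}(vu) \text{ for } e=\{u,v\}\in E\rangle$, where ${}_{m}(uv)$ is the alternating product $uvu\cdots$ of length $m$. It is even if all labels are even. A triangle graph is the complete graph on three vertices (each of the three edges carrying an even label $\ge 2$). A group $G$ is poly-free if there is a chain $1=G_0\unlhd G_1\unlhd\cdots\unlhd G_N=G$ with each $G_{i+1}/G_i$ free. *)

theory Defs
  imports "HOL-Algebra.Algebra"
begin

section \<open>Words over an alphabet with signs (True = letter, False = inverse)\<close>

definition words_on :: "'v set \<Rightarrow> ('v \<times> bool) list set" where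
  "words_on V = {w. set (map fst w) \<subseteq> V}"

fun alt_word :: "'v \<Rightarrow> 'v \<Rightarrow> nat \<Rightarrow> ('v \<times> bool) list" where
  "alt_word x y 0 = []"
| "alt_word x y (Suc k) = (x, True) # alt_word y x k"

inductive_set artin_eq :: "'v set \<Rightarrow> 'v set set \<Rightarrow> ('v set \<Rightarrow> nat)
    \<Rightarrow> (('v \<times> bool) list \<times> ('v \<times> bool) list) set"
  for V E m where
  refl: "w \<in> words_on V \<Longrightarrow> (w, w) \<in> artin_eq V E m"
| sym: "(u, w) \<in> artin_eq V E m \<Longrightarrow> (w, u) \<in> artin_eq V E m"
| trans: "(u, v) \<in> artin_eq V E m \<Longrightarrow> (v, w) \<in> artin_eq V E m \<Longrightarrow> (u, w) \<in> artin_eq V E m"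
| cancel: "u \<in> words_on V \<Longrightarrow> w \<in> words_on V \<Longrightarrow> x \<in> V \<Longrightarrow>
      (u @ [(x, b), (x, \<not> b)] @ w, u @ w) \<in> artin_eq V E m"
| rel: "u \<in> words_on V \<Longrightarrow> w \<in> words_on V \<Longrightarrow> {x, y} \<in> E \<Longrightarrow> x \<in> V \<Longrightarrow> y \<in> V \<Longrightarrow>
      (u @ alt_word x y (m {x, y}) @ w, u @ alt_word y x (m {x, y}) @ w) \<in> artin_eq V E m"

definition artin_group :: "'v set \<Rightarrow> 'v set set \<Rightarrow> ('v set \<Rightarrow> nat)
    \<Rightarrow> ('v \<times> bool) list set monoid" where
  "artin_group V E m =
    \<lparr> carrier = words_on V // artin_eq V E m,
      monoid.mult = (\<lambda>A B. \<Union>a\<in>A. \<Union>b\<in>B. artin_eq V E m `` {a @ b}),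
      one = artin_eq V E m `` {[]} \<rparr>"

fun reduced_word :: "('a \<times> bool) list \<Rightarrow> bool" where
  "reduced_word (x # y # ws) = (\<not> (fst x = fst y \<and> snd x \<noteq> snd y) \<and> reduced_word (y # ws))"
| "reduced_word _ = True"

definition eval_word :: "('a, 'b) monoid_scheme \<Rightarrow> ('a \<times> bool) list \<Rightarrow> 'a" where
  "eval_word G w = foldr (\<lambda>(x, b) acc. (if b then x else inv\<^bsub>G\<^esub> x) \<otimes>\<^bsub>G\<^esub> acc) w \<one>\<^bsub>G\<^esub>"

definition free_group :: "('a, 'b) monoid_scheme \<Rightarrow> bool" where
  "free_group G \<longleftrightarrow> group G \<and> (\<exists>S \<subseteq> carrier G.
      (\<forall>g \<in> carrier G. \<exists>w. set (map fst w) \<subseteq> S \<and> eval_word G w = g) \<and>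
      (\<forall>w. set (map fst w) \<subseteq> S \<and> reduced_word w \<and> w \<noteq> [] \<longrightarrow> eval_word G w \<noteq> \<one>\<^bsub>G\<^esub>))"

definition poly_free :: "('a, 'b) monoid_scheme \<Rightarrow> bool" where
  "poly_free G \<longleftrightarrow> group G \<and> (\<exists>(N::nat) (H :: nat \<Rightarrow> 'a set).
      H 0 = {\<one>\<^bsub>G\<^esub>} \<and> H N = carrier G \<and>
      (\<forall>i < N. subgroup (H i) G \<and> subgroup (H (Suc i)) G \<and> H i \<subseteq> H (Suc i) \<and>
         normal (H i) (G\<lparr>carrier := H (Suc i)\<rparr>) \<and>
         free_group ((G\<lparr>carrier := H (Suc i)\<rparr>) Mod (H i))))"

end

(* Let x = a, y = b, z = c, and let the labels of ab, bc, ac be 2k, 2l, 2n. Killing c gives a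
   retraction onto the dihedral Artin group Q of ab, killing also b a retraction onto Z = <a>. The
   three successive quotients of the resulting chain are shown to be free.

   The kernel of the retraction onto Q is generated by the conjugates c_g (g in Q). The relations for
   ac and bc say that along each coset g<a> (resp. g<b>) the product of n (resp. l) consecutive
   conjugates is constant. After a permutation of the vertices either k, l >= 2, and then the tree-like
   shape of the Cayley graph of Q lets one solve all these relations step by step away from a base
   point, leaving a set of free generators; or l = n = 1 and all c_g coincide. Freeness is
   detected by letting the Artin group act on F x Q, where F is a free group, a and b move the second
   coordinate, and c multiplies the first one by a prescribed solution of the relations. The kernel
   of Q -> Z is treated in the same way, with the integers in place of Q. *)
theory Submission
  imports Defs
begin

section \<open>Lines in a group\<close>

text \<open>Each element of Q lies on one coset of <a> and on one of <b>, so its conjugate of c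
  could be forced twice, in contradictory ways. The task is therefore combinatorial: choose on every
  coset a window of n (resp. l) consecutive places, whose values fix the rest of the coset, such
  that no element is outside both of its windows and such that passing from an element outside a
  window to the places of that window is well founded. The elements inside both windows index the
  free generators. The same recursion serves twice: in the Artin group it shows that these
  conjugates generate, and in a group of permutations of reduced words, where the parameters can be
  prescribed at will, it shows that they are independent. For n = 1 a window is a single place, so
  its position is delicate; the shift by one in \<open>pos\<close> has its origin there. Q is
  represented by an explicit graph on which a and b act, and the kernel is taken to be that of this
  action.\<close>

primrec lprod :: "('a, 'b) monoid_scheme \<Rightarrow> (nat \<Rightarrow> 'a) \<Rightarrow> nat \<Rightarrow> 'a" where
  "lprod G u 0 = \<one>\<^bsub>G\<^esub>"
| "lprod G u (Suc N) = lprod G u N \<otimes>\<^bsub>G\<^esub> u N"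

text \<open>If c and x generate a dihedral Artin group of label 2 * N, the conjugates
  of c by the powers of x form a bi-infinite sequence of this kind; N consecutive
  entries can be prescribed freely and determine all others.\<close>

definition is_line :: "('a, 'b) monoid_scheme \<Rightarrow> nat \<Rightarrow> (int \<Rightarrow> 'a) \<Rightarrow> bool" where
  "is_line G N v \<longleftrightarrow> (\<forall>i. v i \<in> carrier G) \<and>
     (\<forall>i. lprod G (\<lambda>j. v (i + int j)) N = lprod G (\<lambda>j. v (i + 1 + int j)) N)"

text \<open>The solution of v (i + N) = W^(-1) v i W with the given entries at 0, ..., N - 1, where
  W is their product.\<close>

definition line_val :: "('a, 'b) monoid_scheme \<Rightarrow> nat \<Rightarrow> (nat \<Rightarrow> 'a) \<Rightarrow> int \<Rightarrow> 'a" where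
  "line_val G N v i = (lprod G v N [^]\<^bsub>G\<^esub> (- (i div int N))) \<otimes>\<^bsub>G\<^esub> v (nat (i mod int N))
     \<otimes>\<^bsub>G\<^esub> (lprod G v N [^]\<^bsub>G\<^esub> (i div int N))"

lemma lprod_cong: "(\<And>j. j < N \<Longrightarrow> u j = v j) \<Longrightarrow> lprod G u N = lprod G v N"
  by (induction N) auto

lemma is_line_shift:
  assumes "is_line G N v"
  shows "is_line G N (\<lambda>i. v (i + k))"
proof -
  have eq: "i + 1 + int j + k = (i + k) + 1 + int j" "i + int j + k = (i + k) + int j" "i + 1 + k + int j = (i + k) + 1 + int j" for i j
    by simp_all
  show ?thesis using assms unfolding is_line_def eq by blast
qed

context group
begin

lemma lprod_closed: "(\<And>j. j < N \<Longrightarrow> u j \<in> carrier G) \<Longrightarrow> lprod G u N \<in> carrier G"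
  by (induction N) auto

lemma lprod_Suc_left:
  "(\<And>j. u j \<in> carrier G) \<Longrightarrow> lprod G u (Suc N) = u 0 \<otimes> lprod G (\<lambda>j. u (Suc j)) N"
  by (induction N) (auto simp: m_assoc lprod_closed)

lemma lprod_subgroup:
  "subgroup M G \<Longrightarrow> (\<And>j. j < N \<Longrightarrow> u j \<in> M) \<Longrightarrow> lprod G u N \<in> M"
  by (induction N) (auto simp: subgroup.one_closed subgroup.m_closed)

text \<open>The product of N + 1 consecutive entries, with one factor split off on the left or on
  the right.\<close>

lemma lprod_slide:
  fixes v :: "int \<Rightarrow> 'a"
  assumes "\<And>i. v i \<in> carrier G"
  shows "v i \<otimes> lprod G (\<lambda>j. v (i + 1 + int j)) N = lprod G (\<lambda>j. v (i + int j)) N \<otimes> v (i + int N)"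
  using lprod_Suc_left[of "\<lambda>j. v (i + int j)" N] assms by (simp add: add.assoc)

text \<open>All products of N consecutive entries agree with the one starting at 0, so sliding by
  one place shows that a shift by N is conjugation by that product.\<close>

lemma is_line_step:
  assumes v: "is_line G N v"
  shows "v i \<otimes> lprod G (\<lambda>j. v (int j)) N = lprod G (\<lambda>j. v (int j)) N \<otimes> v (i + int N)"
proof -
  have c: "\<And>i. v i \<in> carrier G" using v by (simp add: is_line_def)
  have const: "lprod G (\<lambda>j. v (i + int j)) N = lprod G (\<lambda>j. v (int j)) N" for i
  proof (induction i rule: int_induct[where k = 0])
    case base
    show ?case by simp
  next
    case (step1 i)
    then show ?case using v unfolding is_line_def by auto
  next
    case (step2 i)
    have "lprod G (\<lambda>j. v (i - 1 + int j)) N = lprod G (\<lambda>j. v (i - 1 + 1 + int j)) N"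
      using v unfolding is_line_def by blast
    with step2 show ?case by simp
  qed
  show ?thesis using lprod_slide[of v i N, OF c] const[of i] const[of "i + 1"] by simp
qed

text \<open>The product of the base entries lies in M, and conjugation by it or its inverse carries
  entries N places along.\<close>

lemma is_line_subgroup:
  assumes v: "is_line G N v" and N: "N \<ge> 1" and M: "subgroup M G"
    and base: "\<And>i. 0 \<le> i \<Longrightarrow> i < int N \<Longrightarrow> v i \<in> M"
  shows "v i \<in> M"
proof -
  let ?W = "lprod G (\<lambda>j. v (int j)) N"
  have c: "\<And>i. v i \<in> carrier G" using v by (simp add: is_line_def)
  have W: "?W \<in> M" by (rule lprod_subgroup[OF M]) (simp add: base)
  have Wc: "?W \<in> carrier G" by (rule subgroup.mem_carrier[OF M W])
  have up: "v (i + int N) \<in> M" if "v i \<in> M" for i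
  proof -
    have "v (i + int N) = inv ?W \<otimes> (v i \<otimes> ?W)"
      using is_line_step[OF v, of i] c Wc by (simp add: inv_solve_left)
    then show ?thesis using M W that by (simp add: subgroup.m_closed subgroup.m_inv_closed)
  qed
  have down: "v i \<in> M" if "v (i + int N) \<in> M" for i
  proof -
    have "v i = ?W \<otimes> v (i + int N) \<otimes> inv ?W"
      using is_line_step[OF v, of i] c Wc by (simp add: inv_solve_right)
    then show ?thesis using M W that by (simp add: subgroup.m_closed subgroup.m_inv_closed)
  qed
  have all: "v (r + q * int N) \<in> M" if r: "0 \<le> r" "r < int N" for r q
  proof (induction q rule: int_induct[where k = 0])
    case base then show ?case using assms(4) r by simp
  next
    case (step1 q)
    then show ?case using up[of "r + q * int N"] by (simp add: algebra_simps)
  next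
    case (step2 q)
    then show ?case using down[of "r + (q - 1) * int N"] by (simp add: algebra_simps)
  qed
  have "0 \<le> i mod int N" "i mod int N < int N" using N by auto
  from all[OF this, of "i div int N"] show ?thesis by simp
qed

lemma line_val_base: "j < N \<Longrightarrow> (\<And>j. j < N \<Longrightarrow> v j \<in> carrier G) \<Longrightarrow> line_val G N v (int j) = v j"
  by (simp add: line_val_def lprod_closed)

text \<open>Since a shift by N is conjugation by W, a window with product W keeps this product when
  it slides by one place; the induction starts at the window at 0 and runs both ways.\<close>

lemma line_val_is_line:
  assumes N: "N \<ge> 1" and c: "\<And>j. j < N \<Longrightarrow> v j \<in> carrier G"
  shows "is_line G N (line_val G N v)"
proof -
  let ?W = "lprod G v N" and ?u = "line_val G N v"
  have W: "?W \<in> carrier G" by (simp add: c lprod_closed)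
  have r: "nat (i mod int N) < N" for i using N by (simp add: nat_less_iff)
  have uc: "?u i \<in> carrier G" for i by (simp add: line_val_def W c r)
  have per: "?u (i + int N) = inv ?W \<otimes> ?u i \<otimes> ?W" for i
  proof -
    have d: "(i + int N) div int N = i div int N + 1" "(i + int N) mod int N = i mod int N"
      using N by auto
    have neg: "?W [^] (- (q + 1)) = inv ?W \<otimes> ?W [^] (- q)" for q :: int
    proof -
      have "- (q + 1) = - 1 + - q" by simp
      then show ?thesis using int_pow_mult[OF W, of "- 1" "- q"] W by (simp only: int_pow_neg int_pow_1)
    qed
    have pos: "?W [^] (q + 1) = ?W [^] q \<otimes> ?W" for q :: int
      using int_pow_mult[OF W, of q 1] W by simp
    show ?thesis
      unfolding line_val_def d neg pos using W c[OF r[of i]] by (simp add: m_assoc)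
  qed
  have const: "lprod G (\<lambda>j. ?u (i + int j)) N = ?W" for i
  proof (induction i rule: int_induct[where k = 0])
    case base
    show ?case by (auto intro!: lprod_cong simp: line_val_base c)
  next
    case (step1 i)
    let ?X = "lprod G (\<lambda>j. ?u (i + 1 + int j)) N"
    have X: "?X \<in> carrier G" by (auto intro: lprod_closed uc)
    have "?u i \<otimes> ?X = ?W \<otimes> (inv ?W \<otimes> ?u i \<otimes> ?W)"
      using lprod_slide[of ?u, OF uc, where N = N and i = i] step1 per by simp
    also have "\<dots> = ?u i \<otimes> ?W" using W uc by (simp add: m_assoc[symmetric])
    finally show ?case using X W uc by simp
  next
    case (step2 i)
    let ?X = "lprod G (\<lambda>j. ?u (i - 1 + int j)) N"
    have X: "?X \<in> carrier G" by (auto intro: lprod_closed uc)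
    have u: "?u (i - 1) \<in> carrier G" by (rule uc)
    have "lprod G (\<lambda>j. ?u (i - 1 + 1 + int j)) N = ?W" using step2(2) by simp
    then have "?u (i - 1) \<otimes> ?W = ?X \<otimes> (inv ?W \<otimes> ?u (i - 1) \<otimes> ?W)"
      using lprod_slide[of ?u "i - 1" N, OF uc] unfolding per by simp
    also have "\<dots> = (?X \<otimes> inv ?W) \<otimes> (?u (i - 1) \<otimes> ?W)"
      using X W u by (simp only: m_assoc m_closed inv_closed)
    finally have "(?X \<otimes> inv ?W) \<otimes> (?u (i - 1) \<otimes> ?W) = \<one> \<otimes> (?u (i - 1) \<otimes> ?W)"
      using u W by (simp only: l_one m_closed)
    then have "?X \<otimes> inv ?W = \<one>" using X W u by (simp only: r_cancel m_closed inv_closed one_closed)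
    then have "?X = inv (inv ?W)" using X W by (intro inv_equality[symmetric]) auto
    then show ?case using W by simp
  qed
  have "lprod G (\<lambda>j. ?u (i + int j)) N = lprod G (\<lambda>j. ?u (i + 1 + int j)) N" for i
    unfolding const[of i] const[of "i + 1"] ..
  then show ?thesis unfolding is_line_def using uc by blast
qed

end

section \<open>Solving line systems\<close>

text \<open>Every u lies on two lines, its own orbit and that of flip u. On each line the
  entries at the positions 0 to rank u - 1 determine the others; a system of values is
  solvable with free parameters as soon as no point is determined by both of its lines and the
  dependencies are well founded.\<close>

locale windows =
  fixes U :: "'u set" and flip :: "'u \<Rightarrow> 'u" and orb :: "'u \<Rightarrow> int \<Rightarrow> 'u"
    and pos :: "'u \<Rightarrow> int" and rank :: "'u \<Rightarrow> nat" and \<mu> :: "'u \<Rightarrow> nat"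
  assumes orb_in: "u \<in> U \<Longrightarrow> orb u i \<in> U"
    and orb_0: "u \<in> U \<Longrightarrow> orb u 0 = u"
    and orb_add: "u \<in> U \<Longrightarrow> orb (orb u i) j = orb u (i + j)"
    and flip_in: "u \<in> U \<Longrightarrow> flip u \<in> U"
    and flip_flip: "u \<in> U \<Longrightarrow> flip (flip u) = u"
    and pos_orb: "u \<in> U \<Longrightarrow> pos (orb u i) = pos u + i"
    and rank_orb: "u \<in> U \<Longrightarrow> rank (orb u i) = rank u"
    and rank_pos: "u \<in> U \<Longrightarrow> rank u \<ge> 1"
    and \<mu>_flip: "u \<in> U \<Longrightarrow> \<mu> (flip u) = \<mu> u"
    and one_out: "u \<in> U \<Longrightarrow> pos u \<notin> {0..<int (rank u)} \<Longrightarrow> pos (flip u) \<in> {0..<int (rank (flip u))}"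
    and descent: "u \<in> U \<Longrightarrow> pos u \<notin> {0..<int (rank u)} \<Longrightarrow> i \<in> {0..<int (rank u)} \<Longrightarrow>
        \<mu> (orb u (i - pos u)) < \<mu> u"
begin

definition out :: "'u \<Rightarrow> bool" where
  "out u \<longleftrightarrow> pos u \<notin> {0..<int (rank u)}"

definition free :: "'u \<Rightarrow> bool" where
  "free u \<longleftrightarrow> \<not> out u \<and> \<not> out (flip u)"

lemma not_both_out: "u \<in> U \<Longrightarrow> out u \<Longrightarrow> \<not> out (flip u)"
  using one_out by (auto simp: out_def)

text \<open>A point is free, or out on its own line, or out on the other one. In the last two cases
  the window of that line has smaller \<mu>, and its entries yield all the others inside M.\<close>

lemma free_generate:
  assumes G: "group G" and M: "subgroup M G"
    and D_flip: "\<And>u. u \<in> U \<Longrightarrow> D (flip u) = D u"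
    and D_line: "\<And>u. u \<in> U \<Longrightarrow> is_line G (rank u) (\<lambda>i. D (orb u i))"
    and D_free: "\<And>u. u \<in> U \<Longrightarrow> free u \<Longrightarrow> D u \<in> M"
  shows "u \<in> U \<Longrightarrow> D u \<in> M"
proof (induction u rule: measure_induct_rule[of \<mu>])
  case (less u)
  have out: "D w \<in> M" if w: "w \<in> U" "out w" "\<mu> w = \<mu> u" for w
  proof -
    \<comment> \<open>The point at position 0 of the line, from which the window has the indices 0,
      ..., \<open>rank w\<close> - 1.\<close>
    let ?o = "orb w (- pos w)"
    have o: "?o \<in> U" using w orb_in by blast
    have rank: "rank ?o = rank w" using w rank_orb by simp
    have "D (orb ?o i) \<in> M" for i
    proof (rule group.is_line_subgroup[OF G D_line[OF o] _ M])
      show "1 \<le> rank ?o" using rank_pos o by blast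
      fix i :: int assume "0 \<le> i" "i < int (rank ?o)"
      then have "i \<in> {0..<int (rank w)}" using rank by simp
      then have "\<mu> (orb w (i - pos w)) < \<mu> w" using descent[of w i] w(1,2) unfolding out_def by blast
      then have "D (orb w (i - pos w)) \<in> M" using less.IH[of "orb w (i - pos w)"] w orb_in by simp
      then show "D (orb ?o i) \<in> M" using w orb_add by simp
    qed
    from this[of "pos w"] show ?thesis using w orb_add orb_0 by simp
  qed
  consider "out u" | "out (flip u)" | "free u" by (auto simp: free_def)
  then show ?case
  proof cases
    case 2
    then have "D (flip u) \<in> M" using out less.prems flip_in \<mu>_flip by simp
    then show ?thesis using D_flip less.prems by simp
  qed (use out less.prems D_free in auto)
qed

section \<open>Recursive solution of the line system with prescribed free values\<close>

definition ext_step :: "('a, 'b) monoid_scheme \<Rightarrow> ('u \<Rightarrow> 'a) \<Rightarrow> ('u \<Rightarrow> 'a) \<Rightarrow> 'u \<Rightarrow> 'a" where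
  "ext_step G f C u =
     (if out u then line_val G (rank u) (\<lambda>j. C (orb u (int j - pos u))) (pos u)
      else if out (flip u) then
        line_val G (rank (flip u)) (\<lambda>j. C (orb (flip u) (int j - pos (flip u)))) (pos (flip u))
      else f u)"

definition ext :: "('a, 'b) monoid_scheme \<Rightarrow> ('u \<Rightarrow> 'a) \<Rightarrow> 'u \<Rightarrow> 'a" where
  "ext G f = wfrec (measure \<mu>) (ext_step G f)"

lemma line_val_cong: "N \<ge> 1 \<Longrightarrow> (\<And>j. j < N \<Longrightarrow> u j = v j) \<Longrightarrow> line_val G N u i = line_val G N v i"
  by (auto simp: line_val_def nat_less_iff cong: lprod_cong)

lemma ext_unfold:
  assumes u: "u \<in> U"
  shows "ext G f u = ext_step G f (ext G f) u"
proof -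
  \<comment> \<open>Recursive calls go to window points of a line on which the point is out; by
    \<open>descent\<close> these have smaller measure, so the restriction by \<open>cut\<close> has
    no effect on them.\<close>
  have cut: "cut (ext G f) (measure \<mu>) u (orb w (int j - pos w)) = ext G f (orb w (int j - pos w))"
    if "w \<in> U" "out w" "\<mu> w = \<mu> u" "j < rank w" for w j
    using that descent[of w "int j"] by (simp add: cut_def out_def)
  have "ext G f u = ext_step G f (cut (ext G f) (measure \<mu>) u) u"
    unfolding ext_def by (rule wfrec) simp
  also have "\<dots> = ext_step G f (ext G f) u"
    unfolding ext_step_def using u cut[of u] cut[of "flip u"] flip_in \<mu>_flip rank_pos
    by (auto intro!: line_val_cong)
  finally show ?thesis .
qed

context
  fixes G :: "('a, 'b) monoid_scheme" and f :: "'u \<Rightarrow> 'a"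
  assumes G: "group G" and f: "\<And>u. u \<in> U \<Longrightarrow> f u \<in> carrier G"
    and f_flip: "\<And>u. u \<in> U \<Longrightarrow> f (flip u) = f u"
begin

text \<open>The two determined cases of \<open>ext_step\<close> exclude each other, so replacing u
  by its flip just exchanges them.\<close>

lemma ext_flip: "u \<in> U \<Longrightarrow> ext G f (flip u) = ext G f u"
  using not_both_out[of u]
  by (simp add: ext_unfold flip_in ext_step_def flip_flip f_flip)

lemma ext_free: "u \<in> U \<Longrightarrow> free u \<Longrightarrow> ext G f u = f u"
  by (simp add: ext_unfold ext_step_def free_def)

lemma line_val_closed:
  assumes "N \<ge> 1" "\<And>j. j < N \<Longrightarrow> v j \<in> carrier G"
  shows "line_val G N v i \<in> carrier G"
  using group.line_val_is_line[OF G assms] by (auto simp: is_line_def)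

lemma ext_closed: "u \<in> U \<Longrightarrow> ext G f u \<in> carrier G"
proof (induction u rule: measure_induct_rule[of \<mu>])
  case (less u)
  have *: "ext G f (orb w (int j - pos w)) \<in> carrier G"
    if "w \<in> U" "out w" "\<mu> w = \<mu> u" "j < rank w" for w j
    using that descent[of w "int j"] less.IH orb_in by (simp add: out_def)
  show ?case
    unfolding ext_unfold[OF less.prems] ext_step_def
    using *[of u] *[of "flip u"] less.prems f rank_pos flip_in \<mu>_flip
    by (auto intro!: line_val_closed)
qed

lemma ext_line:
  assumes u: "u \<in> U"
  shows "is_line G (rank u) (\<lambda>i. ext G f (orb u i))"
proof -
  let ?o = "orb u (- pos u)"
  let ?v = "\<lambda>j. ext G f (orb ?o (int j))"
  have o: "?o \<in> U" "pos ?o = 0" "rank ?o = rank u"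
    using u orb_in pos_orb rank_orb by auto
  have v: "?v j \<in> carrier G" for j using o orb_in ext_closed by blast
  have N: "rank u \<ge> 1" using u rank_pos by blast
  have val: "ext G f (orb ?o i) = line_val G (rank u) ?v i" for i
  proof (cases "out (orb ?o i)")
    case True
    have "ext G f (orb ?o i) = line_val G (rank u) (\<lambda>j. ext G f (orb (orb ?o i) (int j - i))) i"
      using True ext_unfold[of "orb ?o i"] o orb_in pos_orb rank_orb by (simp add: ext_step_def)
    then show ?thesis using orb_add o by simp
  next
    \<comment> \<open>Inside the window there is no equation to check: \<open>line_val\<close>
      returns the window entry itself, whether it is free or was computed from its other
      line.\<close>
    case False
    then have "0 \<le> i" "i < int (rank u)" using o pos_orb rank_orb by (auto simp: out_def)
    then show ?thesis
      using group.line_val_base[OF G, of "nat i" "rank u" ?v] v by (simp add: nat_less_iff)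
  qed
  have eq: "(\<lambda>i. ext G f (orb ?o i)) = line_val G (rank u) ?v"
    by (rule HOL.ext) (rule val)
  have L: "is_line G (rank u) (\<lambda>i. ext G f (orb ?o i))"
    by (rule back_subst[of "is_line G (rank u)", OF group.line_val_is_line[OF G N v]]) (rule eq[symmetric])
  have "is_line G (rank u) (\<lambda>i. ext G f (orb ?o (i + pos u)))"
    by (rule is_line_shift[OF L])
  then show ?thesis using orb_add u by simp
qed

end

end

section \<open>The tree-like Cayley graph of a dihedral Artin group\<close>

definition zpow :: "('u \<Rightarrow> 'u) \<Rightarrow> ('u \<Rightarrow> 'u) \<Rightarrow> 'u \<Rightarrow> int \<Rightarrow> 'u" where
  "zpow f g u i = (if i \<ge> 0 then (f ^^ nat i) u else (g ^^ nat (- i)) u)"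

lemma zpow_of_nat: "zpow f g u (int n) = (f ^^ n) u"
  by (simp add: zpow_def)

context
  fixes f g :: "'u \<Rightarrow> 'u" and U :: "'u set"
  assumes f: "\<And>u. u \<in> U \<Longrightarrow> f u \<in> U" and g: "\<And>u. u \<in> U \<Longrightarrow> g u \<in> U"
    and fg: "\<And>u. u \<in> U \<Longrightarrow> f (g u) = u" and gf: "\<And>u. u \<in> U \<Longrightarrow> g (f u) = u"
begin

lemma funpow_in: "u \<in> U \<Longrightarrow> (f ^^ n) u \<in> U" "u \<in> U \<Longrightarrow> (g ^^ n) u \<in> U"
  by (induction n) (auto simp: f g)

lemma zpow_in: "u \<in> U \<Longrightarrow> zpow f g u i \<in> U"
  by (simp add: zpow_def funpow_in)

lemma zpow_plus_1: 
  assumes u: "u \<in> U" shows "zpow f g u (i + 1) = f (zpow f g u i)"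
proof (cases "i \<ge> 0")
  case True
  then show ?thesis by (simp add: zpow_def nat_add_distrib)
next
  case False
  then obtain n where n: "nat (- i) = Suc n" by (metis not0_implies_Suc nat_0_iff not_le neg_le_0_iff_le)
  then have "nat (- (i + 1)) = n" "i + 1 \<ge> 0 \<longleftrightarrow> n = 0" "i + 1 \<ge> 0 \<Longrightarrow> i + 1 = 0" by auto
  then show ?thesis using n u False by (auto simp: zpow_def fg funpow_in)
qed

lemma zpow_minus_1: "u \<in> U \<Longrightarrow> zpow f g u (i - 1) = g (zpow f g u i)"
  using zpow_plus_1[of u "i - 1"] gf zpow_in by simp

lemma zpow_add: "u \<in> U \<Longrightarrow> zpow f g (zpow f g u i) j = zpow f g u (i + j)"
proof (induction j rule: int_induct[where k = 0])
  case base
  then show ?case by (simp add: zpow_def)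
next
  case (step1 j)
  then show ?case using zpow_plus_1 zpow_in by (simp add: add.assoc[symmetric])
next
  case (step2 j)
  then show ?case using zpow_minus_1 zpow_in by (simp add: add_diff_eq)
qed

end

text \<open>The group \<langle>a, b | (ab)^k = (ba)^k\<rangle> has as Cayley graph a tree of bi-infinite zigzag paths
  labelled alternately by a and b: each vertex lies on exactly two zigzags, and two
  neighbouring zigzags share the vertices whose index is in one fixed class modulo m = 2 * k.
  A node (rs, j) is the vertex of index j on the zigzag that is reached from the root by
  leaving through the classes in rs (most recent first). The two descriptions of one vertex
  are exchanged by toggle. The index always increases by one along an edge.\<close>

type_synonym node = "int list \<times> int"

definition nodes :: "int \<Rightarrow> node set" where
  "nodes m = {u. distinct_adj (fst u) \<and> (\<forall>h \<in> set (fst u). h mod m = h)}"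

fun toggle :: "int \<Rightarrow> node \<Rightarrow> node" where
  "toggle m ([], j) = ([j mod m], j)"
| "toggle m (h # rs, j) = (if h = j mod m then (rs, j) else (j mod m # h # rs, j))"

text \<open>One step along an a-line (from an even node) or a b-line (from an odd node).\<close>

definition tau :: "int \<Rightarrow> node \<Rightarrow> node" where
  "tau m u = toggle m (fst u, snd u + 1)"

definition tau' :: "int \<Rightarrow> node \<Rightarrow> node" where
  "tau' m u = (fst (toggle m u), snd u - 1)"

definition evn :: "node \<Rightarrow> bool" where
  "evn u \<longleftrightarrow> even (snd u + int (length (fst u)))"

abbreviation orb :: "int \<Rightarrow> node \<Rightarrow> int \<Rightarrow> node" where
  "orb m \<equiv> zpow (tau m) (tau' m)"

lemma mod_add_neq: "0 < d \<Longrightarrow> d < m \<Longrightarrow> (j + d) mod m \<noteq> j mod (m::int)"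
  using zdvd_not_zless[of d m] by (auto simp: mod_eq_dvd_iff)

lemma snd_toggle [simp]: "snd (toggle m u) = snd u"
  by (cases "(m, u)" rule: toggle.cases) auto

lemma toggle_in: "u \<in> nodes m \<Longrightarrow> toggle m u \<in> nodes m"
  by (cases "(m, u)" rule: toggle.cases) (auto simp: nodes_def dest: distinct_adj_ConsD)

lemma toggle_toggle: "u \<in> nodes m \<Longrightarrow> toggle m (toggle m u) = u"
proof (cases "(m, u)" rule: toggle.cases)
  case (2 m' h rs j)
  assume "u \<in> nodes m"
  with 2 show ?thesis by (cases rs) (auto simp: nodes_def)
qed auto

lemma evn_toggle: "evn (toggle m u) \<longleftrightarrow> \<not> evn u"
  by (cases "(m, u)" rule: toggle.cases) (auto simp: evn_def)

lemma evn_tau: "evn (tau m u) \<longleftrightarrow> evn u"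
  by (auto simp: tau_def evn_toggle) (auto simp: evn_def)

lemma tau_in: "u \<in> nodes m \<Longrightarrow> tau m u \<in> nodes m"
  unfolding tau_def by (rule toggle_in) (simp add: nodes_def)

lemma tau'_in: "u \<in> nodes m \<Longrightarrow> tau' m u \<in> nodes m"
  using toggle_in[of u m] by (simp add: tau'_def nodes_def)

lemma tau_tau': "u \<in> nodes m \<Longrightarrow> tau m (tau' m u) = u"
  using toggle_toggle[of u m] by (simp add: tau'_def tau_def) (metis prod.collapse snd_toggle)

lemma tau'_tau: "u \<in> nodes m \<Longrightarrow> tau' m (tau m u) = u"
  using toggle_toggle[of "(fst u, snd u + 1)" m] by (simp add: tau'_def tau_def nodes_def)

lemma
  assumes "u \<in> nodes m"
  shows orb_in: "orb m u i \<in> nodes m"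
    and orb_plus_1: "orb m u (i + 1) = tau m (orb m u i)"
    and orb_minus_1: "orb m u (i - 1) = tau' m (orb m u i)"
    and orb_add: "orb m (orb m u i) j = orb m u (i + j)"
  using zpow_in[of "nodes m" "tau m" "tau' m"] zpow_plus_1[of "nodes m" "tau m" "tau' m"]
    zpow_minus_1[of "nodes m" "tau m" "tau' m"] zpow_add[of "nodes m" "tau m" "tau' m"]
    tau_in tau'_in tau_tau' tau'_tau assms by (simp_all del: One_nat_def)

lemma orb_0 [simp]: "orb m u 0 = u"
  by (simp add: zpow_def)

lemma evn_orb: "u \<in> nodes m \<Longrightarrow> evn (orb m u i) \<longleftrightarrow> evn u"
proof (induction i rule: int_induct[where k = 0])
  case (step2 i)
  then show ?case using evn_tau[of m "orb m u (i - 1)"] orb_plus_1[of u m "i - 1"] by simp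
qed (auto simp: orb_plus_1 evn_tau)

text \<open>Position on the line, counted from its edge closest to the root zigzag. On a-lines the
  origin is moved to the far end of that edge if the next vertex is shared with the parent zigzag:
  this is what makes n = 1 work.\<close>

fun pos :: "int \<Rightarrow> node \<Rightarrow> int" where
  "pos m ([], j) = 0"
| "pos m (h # rs, j) =
     (if h = j mod m then pos m (rs, j - 1) + 1
      else if h = (j + 1) mod m then pos m (rs, j + 1) - 1
      else if evn (h # rs, j) \<and> h = (j + 2) mod m then - 1 else 0)"

text \<open>The shorter of the two descriptions of a vertex; the length of its list is the distance
  of the vertex from the root zigzag.\<close>

fun settle :: "int \<Rightarrow> node \<Rightarrow> node" where
  "settle m ([], j) = ([], j)"
| "settle m (h # rs, j) = (if h = j mod m then (rs, j) else (h # rs, j))"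

definition near :: "int \<Rightarrow> node \<Rightarrow> bool" where
  "near m u \<longleftrightarrow> fst (settle m u) \<noteq> [] \<and>
     hd (fst (settle m u)) \<in> {(snd u + 1) mod m, (snd u - 1) mod m}"

definition rank :: "nat \<Rightarrow> nat \<Rightarrow> node \<Rightarrow> nat" where
  "rank n l u = (if evn u then n else l)"

definition outside :: "int \<Rightarrow> nat \<Rightarrow> nat \<Rightarrow> node \<Rightarrow> bool" where
  "outside m n l u \<longleftrightarrow> pos m u \<notin> {0..<int (rank n l u)}"

text \<open>Descent measure: vertices determined by neither of their lines come first, then the others by
  their distance from the root zigzag, at equal distance those adjacent to the parent zigzag first.\<close>

definition height :: "int \<Rightarrow> nat \<Rightarrow> nat \<Rightarrow> node \<Rightarrow> nat" where
  "height m n l u =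
     (if outside m n l u \<or> outside m n l (toggle m u)
      then 2 * length (fst (settle m u)) + (if near m u then 1 else 2) else 0)"

lemma settle_toggle: "u \<in> nodes m \<Longrightarrow> settle m (toggle m u) = settle m u"
proof (cases "(m, u)" rule: toggle.cases)
  case (2 m' h rs j)
  assume "u \<in> nodes m"
  with 2 show ?thesis by (cases rs) (auto simp: nodes_def)
qed auto

lemma height_toggle: "u \<in> nodes m \<Longrightarrow> height m n l (toggle m u) = height m n l u"
  by (auto simp: height_def near_def settle_toggle toggle_toggle)

lemma pos_tau:
  assumes "m \<ge> 2"
  shows "pos m (tau m u) = pos m u + 1"
proof -
  have ne: "(j + 1) mod m \<noteq> j mod m" for j using mod_add_neq[of 1 m j] assms by simp
  obtain rs j where u: "u = (rs, j)" by force
  show ?thesis using ne[of j] by (cases rs) (auto simp: u tau_def)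
qed

lemma pos_orb: "m \<ge> 2 \<Longrightarrow> u \<in> nodes m \<Longrightarrow> pos m (orb m u i) = pos m u + i"
proof (induction i rule: int_induct[where k = 0])
  case (step2 i)
  then show ?case using pos_tau[of m "orb m u (i - 1)"] orb_plus_1[of u m "i - 1"] by simp
qed (auto simp: orb_plus_1 pos_tau)

text \<open>The starting vertex of the edge of a line closest to the root (its base edge). No end of
  this edge is shared with the parent zigzag, so the line runs outwards from both ends.\<close>

definition lowest :: "int \<Rightarrow> node \<Rightarrow> bool" where
  "lowest m u \<longleftrightarrow> u \<in> nodes m \<and> (fst u \<noteq> [] \<longrightarrow> hd (fst u) \<notin> {snd u mod m, (snd u + 1) mod m})"

text \<open>If an end of the current edge is shared with the parent zigzag, the neighbouring edge of
  the line lies in the parent zigzag, and the induction continues there.\<close>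

lemma orb_from_lowest:
  "(rs, j) \<in> nodes m \<Longrightarrow> \<exists>e i. lowest m e \<and> (rs, j) = orb m e i"
proof (induction rs arbitrary: j)
  case Nil
  then show ?case by (intro exI[of _ "([], j)"] exI[of _ 0]) (simp add: lowest_def)
next
  case (Cons h rs)
  have rs: "(rs, i) \<in> nodes m" for i using Cons.prems by (auto simp: nodes_def dest: distinct_adj_ConsD)
  show ?case
  proof (cases "h = j mod m")
    case True
    have "(h # rs, j) = tau m (rs, j - 1)" using True Cons.prems by (cases rs) (auto simp: tau_def nodes_def)
    moreover obtain e i where e: "lowest m e" "(rs, j - 1) = orb m e i" using Cons.IH[OF rs] by blast
    ultimately have "(h # rs, j) = orb m e (i + 1)"
      using orb_plus_1[of e m i] by (simp add: lowest_def)
    then show ?thesis using e by blast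
  next
    case ne: False
    show ?thesis
    proof (cases "h = (j + 1) mod m")
      case True
      have "(h # rs, j) = tau' m (rs, j + 1)"
        using True Cons.prems by (cases rs) (auto simp: tau'_def nodes_def)
      moreover obtain e i where e: "lowest m e" "(rs, j + 1) = orb m e i" using Cons.IH[OF rs] by blast
      ultimately have "(h # rs, j) = orb m e (i - 1)"
        using orb_minus_1[of e m i] by (simp add: lowest_def)
      then show ?thesis using e by blast
    next
      case False
      then show ?thesis using ne Cons.prems
        by (intro exI[of _ "(h # rs, j)"] exI[of _ 0]) (simp add: lowest_def)
    qed
  qed
qed

lemma pos_lowest:
  "lowest m (rs, j) \<Longrightarrow> pos m (rs, j) =
     (if rs \<noteq> [] \<and> evn (rs, j) \<and> hd rs = (j + 2) mod m then - 1 else 0)"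
  by (cases rs) (auto simp: lowest_def)

lemma tau_lowest: "lowest m (rs, j) \<Longrightarrow> tau m (rs, j) = ((j + 1) mod m # rs, j + 1)"
  by (cases rs) (auto simp: lowest_def tau_def)

lemma tau'_lowest: "lowest m (rs, j) \<Longrightarrow> tau' m (rs, j) = (j mod m # rs, j - 1)"
  by (cases rs) (auto simp: lowest_def tau'_def)

text \<open>Past the base edge every step enters a new zigzag. The last two classes are kept in the
  statement, because they place the vertex directly after a shared one.\<close>

lemma orb_up:
  assumes m: "m \<ge> 2" and b: "lowest m (rs, j)"
  shows "\<exists>rs'. length rs' = length rs + d \<and> orb m (rs, j) (2 + int d) =
           ((j + 2 + int d) mod m # (j + 1 + int d) mod m # rs', j + 2 + int d)"
proof (induction d)
  case 0
  have n: "(rs, j) \<in> nodes m" using b by (simp add: lowest_def)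
  have "orb m (rs, j) 2 = tau m (tau m (rs, j))"
    using orb_plus_1[OF n, of 1] orb_plus_1[OF n, of 0] by simp
  then show ?case using mod_add_neq[of 1 m "j + 1"] m
    by (simp add: tau_lowest[OF b]) (auto simp: tau_def add.commute)
next
  case (Suc d)
  have n: "(rs, j) \<in> nodes m" using b by (simp add: lowest_def)
  from Suc obtain rs' where rs': "length rs' = length rs + d"
    "orb m (rs, j) (2 + int d) =
           ((j + 2 + int d) mod m # (j + 1 + int d) mod m # rs', j + 2 + int d)" by blast
  have eq: "orb m (rs, j) (2 + int (Suc d)) = tau m (orb m (rs, j) (2 + int d))"
    using orb_plus_1[OF n, of "2 + int d"] by (simp add: add.assoc)
  have t: "tau m ((j + 2 + int d) mod m # (j + 1 + int d) mod m # rs', j + 2 + int d) =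
      ((j + 2 + int (Suc d)) mod m # (j + 1 + int (Suc d)) mod m # (j + 1 + int d) mod m # rs',
       j + 2 + int (Suc d))"
    using mod_add_neq[of 1 m "j + 2 + int d"] m by (simp add: tau_def algebra_simps)
  show ?case using rs'(1)
    by (intro exI[of _ "(j + 1 + int d) mod m # rs'"]) (simp add: eq rs'(2) t del: of_nat_Suc)
qed

lemma orb_down:
  assumes m: "m \<ge> 2" and b: "lowest m (rs, j)"
  shows "\<exists>rs'. length rs' = length rs + d \<and> orb m (rs, j) (- 1 - int d) =
           ((j - int d) mod m # rs', j - 1 - int d)"
proof (induction d)
  case 0
  have n: "(rs, j) \<in> nodes m" using b by (simp add: lowest_def)
  then show ?case using orb_minus_1[OF n, of 0] by (simp add: tau'_lowest[OF b])
next
  case (Suc d)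
  have n: "(rs, j) \<in> nodes m" using b by (simp add: lowest_def)
  from Suc obtain rs' where rs': "length rs' = length rs + d"
    "orb m (rs, j) (- 1 - int d) = ((j - int d) mod m # rs', j - 1 - int d)" by blast
  have eq: "orb m (rs, j) (- 1 - int (Suc d)) = tau' m (orb m (rs, j) (- 1 - int d))"
    using orb_minus_1[OF n, of "- 1 - int d"] by (simp add: algebra_simps)
  have t: "tau' m ((j - int d) mod m # rs', j - 1 - int d) =
      ((j - int (Suc d)) mod m # (j - int d) mod m # rs', j - 1 - int (Suc d))"
    using mod_add_neq[of 1 m "j - 1 - int d"] m by (simp add: tau'_def algebra_simps)
  show ?case using rs'(1)
    by (intro exI[of _ "(j - int d) mod m # rs'"]) (simp add: eq rs'(2) t del: of_nat_Suc)
qed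

section \<open>Each vertex is inside at least one of its two windows, and heights descend into
  windows\<close>

context
  fixes m :: int and n l :: nat
  assumes m: "m \<ge> 4" and n: "n \<ge> 1" and l: "l \<ge> 2"
begin

lemma mods:
  "(j + 1) mod m \<noteq> j mod m" "(j + 1) mod m \<noteq> (j - 1) mod m" "j mod m \<noteq> (j - 1) mod m"
  "(j + 2) mod m \<noteq> (j - 1) mod m" "(j + 2) mod m \<noteq> (j + 1) mod m" "(j + 2) mod m \<noteq> j mod m"
  using m mod_add_neq[of 1 m j] mod_add_neq[of 2 m "j - 1"] mod_add_neq[of 1 m "j - 1"]
    mod_add_neq[of 3 m "j - 1"] mod_add_neq[of 1 m "j + 1"] mod_add_neq[of 2 m j]
  by (simp_all add: algebra_simps)

lemma rank_pos: "rank n l u \<ge> 1"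
  using n l by (simp add: rank_def)

text \<open>A vertex directly after a shared one has position 0: because m \<ge> 4, the class of j -
  1 differs from those of j, j + 1 and j + 2, so no clause of \<open>pos\<close> moves the
  origin.\<close>

lemma outside_next:
  "(h # rs, j) \<in> nodes m \<Longrightarrow> h = (j - 1) mod m \<Longrightarrow> \<not> outside m n l (h # rs, j)"
  using mods[of j] rank_pos[of "(h # rs, j)"] by (auto simp: outside_def)

text \<open>If the edge from j - 1 to j were the base edge of the b-line, the vertex would have
  position 1, which is inside since l \<ge> 2. So the vertex before it must be shared with the
  parent zigzag.\<close>

lemma outside_toggle:
  assumes u: "(rs, j) \<in> nodes m" and nsh: "settle m (rs, j) = (rs, j)" and ev: "evn (rs, j)"
    and out: "outside m n l (toggle m (rs, j))"
  shows "rs \<noteq> [] \<and> hd rs = (j - 1) mod m"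
proof -
  have ne: "rs \<noteq> [] \<Longrightarrow> hd rs \<noteq> j mod m" using nsh by (cases rs) (auto split: if_splits)
  then have t: "toggle m (rs, j) = (j mod m # rs, j)" by (cases rs) auto
  have ev': "\<not> evn (j mod m # rs, j)" "\<not> evn (rs, j - 1)" using ev by (auto simp: evn_def)
  have *: "\<not> lowest m (rs, j - 1)"
    using pos_lowest[of m rs "j - 1"] out l unfolding outside_def
    by (auto simp: t rank_def ev')
  then show ?thesis using u ne by (auto simp: lowest_def nodes_def)
qed

lemma one_outside_settled:
  assumes u: "(rs, j) \<in> nodes m" and nsh: "settle m (rs, j) = (rs, j)"
    and out: "outside m n l (rs, j)" "outside m n l (toggle m (rs, j))"
  shows False
proof (cases "evn (rs, j)")
  case True
  show ?thesis using outside_toggle[OF u nsh True out(2)] outside_next u out(1) by (cases rs) auto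
next
  case False
  have ne: "rs \<noteq> [] \<Longrightarrow> hd rs \<noteq> j mod m" using nsh by (cases rs) (auto split: if_splits)
  then have t: "toggle m (rs, j) = (j mod m # rs, j)" by (cases rs) auto
  have ev: "evn (j mod m # rs, j)" "evn (rs, j - 1)" using False by (auto simp: evn_def)
  have "\<not> lowest m (rs, j)"
    using pos_lowest[of m rs j] out(1) l False unfolding outside_def by (auto simp: rank_def)
  then have h: "rs \<noteq> []" "hd rs = (j + 1) mod m" using u ne by (auto simp: lowest_def nodes_def)
  \<comment> \<open>The a-line has its base edge from j - 1 to j, and j + 1 is shared with the
    parent. This is the shifted case: the position at j is 0, inside the window even for n =
    1.\<close>
  then have "lowest m (rs, j - 1)" using ne u mods[of j] by (auto simp: lowest_def nodes_def)
  then have "pos m (toggle m (rs, j)) = 0"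
    using pos_lowest[of m rs "j - 1"] h ev by (simp add: t add.commute)
  then show ?thesis using out(2) rank_pos[of "toggle m (rs, j)"] by (simp add: outside_def)
qed

lemma settle_cases: "u \<in> nodes m \<Longrightarrow> settle m u = u \<or> settle m (toggle m u) = toggle m u"
proof (cases "(m, u)" rule: toggle.cases)
  case (2 m' h rs j)
  assume "u \<in> nodes m"
  with 2 show ?thesis by (cases rs) (auto simp: nodes_def)
qed auto

lemma one_outside:
  assumes u: "u \<in> nodes m" and out: "outside m n l u"
  shows "\<not> outside m n l (toggle m u)"
proof
  assume out': "outside m n l (toggle m u)"
  from settle_cases[OF u] show False
  proof
    assume "settle m u = u"
    then show False using one_outside_settled[of "fst u" "snd u"] u out out' by simp
  next
    assume "settle m (toggle m u) = toggle m u"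
    moreover obtain rs j where t: "toggle m u = (rs, j)" by force
    ultimately show False
      using one_outside_settled[of rs j] out out' toggle_in[OF u] toggle_toggle[OF u]
      by (simp add: t)
  qed
qed

text \<open>Both u and the window point are located relative to the base edge of their line, at
  steps i and y from its first end. The origin is at step 0, or at step 1 in the shifted
  case.\<close>

lemma height_descends:
  assumes u: "u \<in> nodes m" and out: "outside m n l u" and x: "x \<in> {0..<int (rank n l u)}"
  shows "height m n l (orb m u (x - pos m u)) < height m n l u"
proof -
  have m2: "m \<ge> 2" using m by simp
  obtain rs j i where e: "lowest m (rs, j)" and ui: "u = orb m (rs, j) i"
    using orb_from_lowest[of "fst u" "snd u" m] u by auto
  have en: "(rs, j) \<in> nodes m" using e by (simp add: lowest_def)
  define off where "off = pos m (rs, j)"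
  have off: "off = 0 \<or> off = - 1 \<and> evn (rs, j) \<and> rs \<noteq> [] \<and> hd rs = (j + 2) mod m"
    unfolding off_def pos_lowest[OF e] by simp
  have pu: "pos m u = off + i" using pos_orb[OF m2 en] by (simp add: ui off_def)
  have ru: "rank n l u = rank n l (rs, j)" using evn_orb[OF en] by (simp add: rank_def ui)
  define y where "y = x - off"
  have v: "orb m u (x - pos m u) = orb m (rs, j) y"
    unfolding pu using orb_add[OF en] by (simp add: ui y_def)
  have y: "y \<ge> 0" using x off by (auto simp: y_def)
  have vin: "orb m (rs, j) y \<in> nodes m" using orb_in[OF en] .
  have pv: "pos m (orb m (rs, j) y) = x" using pos_orb[OF m2 en] by (simp add: off_def y_def)
  have rv: "rank n l (orb m (rs, j) y) = rank n l u" by (simp add: ru) (simp add: rank_def evn_orb[OF en])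
  have vout: "\<not> outside m n l (orb m (rs, j) y)" using x by (simp add: outside_def pv rv)
  have hu: "height m n l u = 2 * length (fst (settle m u)) + (if near m u then 1 else 2)"
    using out by (simp add: height_def)
  have hd: "rs \<noteq> [] \<Longrightarrow> hd rs \<noteq> j mod m \<and> hd rs \<noteq> (j + 1) mod m" using e by (simp add: lowest_def)
  have s0: "settle m (rs, j) = (rs, j)" using hd by (cases rs) auto
  have s1: "settle m (orb m (rs, j) 1) = (rs, j + 1)"
    using orb_plus_1[OF en, of 0] hd by (simp add: tau_lowest[OF e])
  have snd1: "snd (orb m (rs, j) 1) = j + 1"
    using orb_plus_1[OF en, of 0] by (simp add: tau_lowest[OF e])
  show ?thesis
  proof (cases "y \<ge> 2")
    case True
    then obtain d where d: "y = 2 + int d" using zle_iff_zadd by blast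
    obtain rs' where o: "orb m (rs, j) y =
        ((j + 2 + int d) mod m # (j + 1 + int d) mod m # rs', j + 2 + int d)"
      using orb_up[OF m2 e, of d] d by auto
    \<comment> \<open>In its other description such a window point comes directly after a shared
      vertex, so it is inside both windows and has height 0.\<close>
    have "toggle m (orb m (rs, j) y) = ((j + 1 + int d) mod m # rs', j + 2 + int d)"
      by (simp add: o)
    moreover have "((j + 1 + int d) mod m # rs', j + 2 + int d) \<in> nodes m"
      using vin by (auto simp: o nodes_def)
    ultimately have "\<not> outside m n l (toggle m (orb m (rs, j) y))"
      using outside_next[of _ rs' "j + 2 + int d"] by (simp add: algebra_simps)
    then have "height m n l (orb m (rs, j) y) = 0" using vout by (simp add: height_def)
    then show ?thesis by (simp add: v hu)
  next
    case False
    then have y01: "y = 0 \<or> y = 1" using y by auto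
    have lv: "length (fst (settle m (orb m (rs, j) y))) = length rs"
      using y01 s0 s1 by auto
    have "height m n l (orb m (rs, j) y) \<le> 2 * length rs + 2" by (simp add: height_def lv)
    \<comment> \<open>One more zigzag of distance adds 2, while the correction term takes only the
      values 1 and 2.\<close>
    then have far: ?thesis if "length (fst (settle m u)) > length rs"
      using that by (simp add: v hu)
    show ?thesis
    proof (cases "i \<ge> 2 \<or> i \<le> - 1")
      case True
      then show ?thesis
      proof
        assume "i \<ge> 2"
        then obtain d where d: "i = 2 + int d" using zle_iff_zadd by blast
        obtain rs' where "length rs' = length rs + d"
          "u = ((j + 2 + int d) mod m # (j + 1 + int d) mod m # rs', j + 2 + int d)"
          using orb_up[OF m2 e, of d] d ui by auto
        then show ?thesis by (intro far) simp
      next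
        assume "i \<le> - 1"
        then obtain d where d: "- 1 = i + int d" using zle_iff_zadd by blast
        then have "i = - 1 - int d" by simp
        then obtain rs' where "length rs' = length rs + d"
          "u = ((j - int d) mod m # rs', j - 1 - int d)"
          using orb_down[OF m2 e, of d] ui by auto
        moreover have "(j - int d) mod m \<noteq> (j - int d - 1) mod m"
          using mods(3)[of "j - int d"] .
        ultimately show ?thesis by (intro far) (simp add: algebra_simps)
      qed
    next
      case False
      then have i01: "i = 0 \<or> i = 1" by auto
      have n1: "int (rank n l u) \<ge> 1" using rank_pos[of u] by simp
      from off show ?thesis
      proof
        \<comment> \<open>Here u is the second end of the base edge and the window consists of the
          first end alone. As l \<ge> 2 this is an a-line. Without a shift u is not near the parent,
          whereas the first end is near as soon as its height is positive.\<close>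
        assume off0: "off = 0"
        then have i: "i = 1" and r: "rank n l u = 1"
          using i01 out n1 by (auto simp: outside_def pu)
        then have ev: "evn (rs, j)" using l r[unfolded ru] by (auto simp: rank_def split: if_splits)
        have y0: "y = 0" using x r off0 by (simp add: y_def)
        have "\<not> (rs \<noteq> [] \<and> hd rs = (j + 2) mod m)"
          using off0 ev pos_lowest[OF e] by (auto simp: off_def)
        then have "\<not> near m u"
          using hd mods[of j] by (auto simp: near_def ui i s1 snd1 add.commute)
        moreover have "settle m u = (rs, j + 1)" by (simp add: ui i s1)
        moreover have "near m (rs, j)" if "outside m n l (toggle m (rs, j))"
          using outside_toggle[OF en s0 ev that] by (simp add: near_def s0)
        ultimately show ?thesis using vout out by (auto simp: v hu y0 height_def s0)
      next
        \<comment> \<open>In the shifted case u is the first end and the window point the second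
          one, which is next to a vertex shared with the parent; the term for \<open>near\<close>
          decides.\<close>
        assume off1: "off = - 1 \<and> evn (rs, j) \<and> rs \<noteq> [] \<and> hd rs = (j + 2) mod m"
        then have i: "i = 0" using i01 out n1 by (auto simp: outside_def pu)
        have y1: "y = 1" using y01 x off1 by (auto simp: y_def)
        have "\<not> near m u" using off1 mods[of j] by (auto simp: near_def ui i s0)
        then have hu2: "height m n l u = 2 * length rs + 2" using hu by (simp add: ui i s0)
        have "near m (orb m (rs, j) 1)" using off1 by (simp add: near_def s1 snd1 add.commute)
        then have "height m n l (orb m (rs, j) y) \<le> 2 * length rs + 1"
          by (simp add: y1 height_def s1)
        then show ?thesis using hu2 by (simp add: v)
      qed
    qed
  qed
qed

lemma windows_nodes:
  "windows (nodes m) (toggle m) (orb m) (pos m) (rank n l) (height m n l)"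
proof
  fix u assume u: "u \<in> nodes m"
  have m2: "m \<ge> 2" using m by simp
  show "rank n l u \<ge> 1" by (rule rank_pos)
  show "rank n l (orb m u i) = rank n l u" for i using evn_orb[OF u] by (simp add: rank_def)
  show "pos m (toggle m u) \<in> {0..<int (rank n l (toggle m u))}" if "pos m u \<notin> {0..<int (rank n l u)}"
    using one_outside[OF u] that by (simp add: outside_def)
  show "height m n l (orb m u (i - pos m u)) < height m n l u"
    if "pos m u \<notin> {0..<int (rank n l u)}" "i \<in> {0..<int (rank n l u)}" for i
    using height_descends[OF u] that by (simp add: outside_def)
qed (use m in \<open>auto simp: orb_in orb_add toggle_in toggle_toggle pos_orb height_toggle simp del: atLeastLessThan_iff\<close>)

end

section \<open>Artin groups and their actions\<close>

text \<open>Actions are on the right because words are read from left to right along paths of the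
  Cayley graph.\<close>

definition right_action :: "('a, 'b) monoid_scheme \<Rightarrow> 's set \<Rightarrow> ('a \<Rightarrow> 's \<Rightarrow> 's) \<Rightarrow> bool" where
  "right_action G \<Omega> r \<longleftrightarrow> (\<forall>g \<in> carrier G. \<forall>s \<in> \<Omega>. r g s \<in> \<Omega>) \<and> (\<forall>s \<in> \<Omega>. r \<one>\<^bsub>G\<^esub> s = s) \<and>
     (\<forall>g \<in> carrier G. \<forall>h \<in> carrier G. \<forall>s \<in> \<Omega>. r (g \<otimes>\<^bsub>G\<^esub> h) s = r h (r g s))"

definition winv :: "('v \<times> bool) list \<Rightarrow> ('v \<times> bool) list" where
  "winv w = rev (map (\<lambda>(x, b). (x, \<not> b)) w)"

definition letter_act :: "'s set \<Rightarrow> ('v \<Rightarrow> 's \<Rightarrow> 's) \<Rightarrow> 'v \<times> bool \<Rightarrow> 's \<Rightarrow> 's" where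
  "letter_act \<Omega> s l = (if snd l then s (fst l) else inv_into \<Omega> (s (fst l)))"

definition cl :: "'v set \<Rightarrow> 'v set set \<Rightarrow> ('v set \<Rightarrow> nat) \<Rightarrow> ('v \<times> bool) list \<Rightarrow> ('v \<times> bool) list set" where
  "cl V E m w = artin_eq V E m `` {w}"

lemma words_on_append [simp]: "u @ v \<in> words_on V \<longleftrightarrow> u \<in> words_on V \<and> v \<in> words_on V"
  by (auto simp: words_on_def)

lemma words_on_Cons [simp]: "l # v \<in> words_on V \<longleftrightarrow> fst l \<in> V \<and> v \<in> words_on V"
  by (auto simp: words_on_def)

lemma words_on_Nil [simp]: "[] \<in> words_on V"
  by (auto simp: words_on_def)

lemma winv_in [simp]: "winv w \<in> words_on V \<longleftrightarrow> w \<in> words_on V"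
  by (induction w) (auto simp: winv_def)

lemma alt_word_in [simp]: "x \<in> V \<Longrightarrow> y \<in> V \<Longrightarrow> alt_word x y k \<in> words_on V"
  by (induction x y k rule: alt_word.induct) auto

context
  fixes V :: "'v set" and E :: "'v set set" and m :: "'v set \<Rightarrow> nat"
begin

lemma artin_eq_in: "(u, w) \<in> artin_eq V E m \<Longrightarrow> u \<in> words_on V \<and> w \<in> words_on V"
  by (induction rule: artin_eq.induct) auto

lemma artin_eq_equiv: "equiv (words_on V) (artin_eq V E m)"
proof (rule equivI)
  show "refl_on (words_on V) (artin_eq V E m)"
    using artin_eq_in by (auto intro: refl_onI artin_eq.refl)
  show "sym (artin_eq V E m)" by (auto intro: symI artin_eq.sym)
  show "trans (artin_eq V E m)" by (auto intro: transI artin_eq.trans)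
qed (use artin_eq_in in auto)

lemma artin_eq_context:
  "(u, w) \<in> artin_eq V E m \<Longrightarrow> p \<in> words_on V \<Longrightarrow> q \<in> words_on V \<Longrightarrow>
     (p @ u @ q, p @ w @ q) \<in> artin_eq V E m"
proof (induction rule: artin_eq.induct)
  case (refl w)
  then show ?case by (intro artin_eq.refl) simp
next
  case (sym u w)
  then show ?case by (blast intro: artin_eq.sym)
next
  case (trans u v w)
  then show ?case by (blast intro: artin_eq.trans)
next
  case (cancel u w x b)
  then show ?case using artin_eq.cancel[of "p @ u" V "w @ q" x b E m] by simp
next
  case (rel u w x y)
  then show ?case using artin_eq.rel[of "p @ u" V "w @ q" x y E m] by simp
qed

lemma artin_eq_append:
  assumes "(u, u') \<in> artin_eq V E m" "(w, w') \<in> artin_eq V E m"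
  shows "(u @ w, u' @ w') \<in> artin_eq V E m"
proof -
  have "(u @ w, u' @ w) \<in> artin_eq V E m"
    using artin_eq_context[OF assms(1), of "[]" w] artin_eq_in[OF assms(2)] by simp
  moreover have "(u' @ w, u' @ w') \<in> artin_eq V E m"
    using artin_eq_context[OF assms(2), of u' "[]"] artin_eq_in[OF assms(1)] by simp
  ultimately show ?thesis by (rule artin_eq.trans)
qed

lemma cl_eq_iff: "u \<in> words_on V \<Longrightarrow> w \<in> words_on V \<Longrightarrow> cl V E m u = cl V E m w \<longleftrightarrow> (u, w) \<in> artin_eq V E m"
  unfolding cl_def by (rule eq_equiv_class_iff[OF artin_eq_equiv])

lemma carrier_artin: "carrier (artin_group V E m) = cl V E m ` words_on V"
  by (auto simp: artin_group_def cl_def quotient_def)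

lemma one_artin: "\<one>\<^bsub>artin_group V E m\<^esub> = cl V E m []"
  by (simp add: artin_group_def cl_def)

lemma mult_artin:
  assumes "u \<in> words_on V" "w \<in> words_on V"
  shows "cl V E m u \<otimes>\<^bsub>artin_group V E m\<^esub> cl V E m w = cl V E m (u @ w)"
proof -
  have "artin_eq V E m `` {a @ b} = cl V E m (u @ w)" if "a \<in> cl V E m u" "b \<in> cl V E m w" for a b
  proof -
    have "(u @ w, a @ b) \<in> artin_eq V E m" using that by (auto simp: cl_def intro: artin_eq_append)
    then show ?thesis using cl_eq_iff[of "u @ w" "a @ b"] artin_eq_in by (metis cl_def)
  qed
  moreover have "u \<in> cl V E m u" "w \<in> cl V E m w"
    using assms by (auto simp: cl_def intro: artin_eq.refl)
  ultimately show ?thesis by (auto simp: artin_group_def)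
qed

lemma artin_eq_winv: "w \<in> words_on V \<Longrightarrow> (winv w @ w, []) \<in> artin_eq V E m"
proof (induction w)
  case Nil
  then show ?case by (simp add: winv_def artin_eq.refl)
next
  case (Cons l w)
  obtain x b where l: "l = (x, b)" by force
  have "(winv w @ [(x, \<not> b), (x, \<not> \<not> b)] @ w, winv w @ w) \<in> artin_eq V E m"
    using Cons.prems l by (intro artin_eq.cancel) auto
  then show ?case using Cons l by (auto simp: winv_def intro: artin_eq.trans)
qed

lemma group_artin: "group (artin_group V E m)"
proof (rule groupI)
  fix x assume "x \<in> carrier (artin_group V E m)"
  then obtain w where w: "w \<in> words_on V" "x = cl V E m w" by (auto simp: carrier_artin)
  then have "cl V E m (winv w) \<otimes>\<^bsub>artin_group V E m\<^esub> x = \<one>\<^bsub>artin_group V E m\<^esub>"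
    using artin_eq_winv[OF w(1)] by (simp add: mult_artin one_artin cl_eq_iff)
  then show "\<exists>y\<in>carrier (artin_group V E m). y \<otimes>\<^bsub>artin_group V E m\<^esub> x = \<one>\<^bsub>artin_group V E m\<^esub>"
    using w by (auto simp: carrier_artin)
qed (auto simp: carrier_artin mult_artin one_artin)

lemma inv_artin: "w \<in> words_on V \<Longrightarrow> inv\<^bsub>artin_group V E m\<^esub> (cl V E m w) = cl V E m (winv w)"
  using artin_eq_winv[of w]
  by (intro group.inv_equality[OF group_artin]) (auto simp: mult_artin one_artin cl_eq_iff carrier_artin)

definition gen :: "'v \<Rightarrow> ('v \<times> bool) list set" where
  "gen x = cl V E m [(x, True)]"

lemma gen_in: "x \<in> V \<Longrightarrow> gen x \<in> carrier (artin_group V E m)"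
  by (auto simp: gen_def carrier_artin)

lemma artin_generate: "carrier (artin_group V E m) = generate (artin_group V E m) (gen ` V)"
proof -
  have "cl V E m w \<in> generate (artin_group V E m) (gen ` V)" if "w \<in> words_on V" for w
    using that
  proof (induction w)
    case Nil
    then show ?case using generate.one[of "artin_group V E m"] by (simp add: one_artin)
  next
    case (Cons l w)
    obtain x b where l: "l = (x, b)" by force
    have x: "x \<in> V" using Cons.prems l by simp
    have "cl V E m [(x, b)] \<in> generate (artin_group V E m) (gen ` V)"
    proof (cases b)
      case True
      then show ?thesis using x generate.incl[of "gen x" "gen ` V" "artin_group V E m"] by (simp add: gen_def)
    next
      case False
      have "inv\<^bsub>artin_group V E m\<^esub> (gen x) \<in> generate (artin_group V E m) (gen ` V)"
        using x by (intro generate.inv) auto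
      then show ?thesis using False x by (simp add: gen_def inv_artin winv_def)
    qed
    from generate.eng[OF this Cons.IH] show ?case using Cons.prems l by (simp add: mult_artin)
  qed
  moreover have "generate (artin_group V E m) (gen ` V) \<subseteq> carrier (artin_group V E m)"
    using gen_in by (intro group.generate_incl[OF group_artin]) auto
  ultimately show ?thesis by (auto simp: carrier_artin)
qed

lemma cl_alt_word:
  assumes "x \<in> V" "y \<in> V"
  shows "cl V E m (alt_word x y (2 * k)) =
    (gen x \<otimes>\<^bsub>artin_group V E m\<^esub> gen y) [^]\<^bsub>artin_group V E m\<^esub> k"
proof (induction k)
  case 0
  then show ?case by (simp add: one_artin)
next
  case (Suc k)
  interpret group "artin_group V E m" by (rule group_artin)
  have "cl V E m (alt_word x y (2 * Suc k)) =
      (gen x \<otimes>\<^bsub>artin_group V E m\<^esub> gen y) \<otimes>\<^bsub>artin_group V E m\<^esub> cl V E m (alt_word x y (2 * k))"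
    using assms by (simp add: gen_def mult_artin)
  then show ?case unfolding Suc.IH using assms gen_in by (simp only: nat_pow_Suc2 m_closed)
qed

lemma artin_relation:
  assumes "{x, y} \<in> E" "x \<in> V" "y \<in> V" "m {x, y} = 2 * k"
  shows "(gen x \<otimes>\<^bsub>artin_group V E m\<^esub> gen y) [^]\<^bsub>artin_group V E m\<^esub> k =
    (gen y \<otimes>\<^bsub>artin_group V E m\<^esub> gen x) [^]\<^bsub>artin_group V E m\<^esub> k"
proof -
  have "(alt_word x y (2 * k), alt_word y x (2 * k)) \<in> artin_eq V E m"
    using artin_eq.rel[of "[]" V "[]" x y E m] assms by simp
  then show ?thesis using assms by (simp add: cl_alt_word[symmetric] cl_eq_iff)
qed

text \<open>The universal property of the presentation: by the relations, running a word depends on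
  its class only, so any representative may be run.\<close>

lemma artin_action:
  fixes s :: "'v \<Rightarrow> 's \<Rightarrow> 's"
  assumes bij: "\<And>x. x \<in> V \<Longrightarrow> bij_betw (s x) \<Omega> \<Omega>"
    and rels: "\<And>x y z. {x, y} \<in> E \<Longrightarrow> x \<in> V \<Longrightarrow> y \<in> V \<Longrightarrow> z \<in> \<Omega> \<Longrightarrow>
      fold (letter_act \<Omega> s) (alt_word x y (m {x, y})) z = fold (letter_act \<Omega> s) (alt_word y x (m {x, y})) z"
  obtains r where "right_action (artin_group V E m) \<Omega> r"
    "\<And>x z. x \<in> V \<Longrightarrow> z \<in> \<Omega> \<Longrightarrow> r (gen x) z = s x z"
proof -
  let ?run = "fold (letter_act \<Omega> s)"
  have step: "letter_act \<Omega> s l z \<in> \<Omega>" if "fst l \<in> V" "z \<in> \<Omega>" for l z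
    using that bij[of "fst l"] by (auto simp: letter_act_def bij_betw_def inv_into_into)
  have run: "?run w z \<in> \<Omega>" if "w \<in> words_on V" "z \<in> \<Omega>" for w z
    using that by (induction w arbitrary: z) (auto simp: step)
  have undo: "letter_act \<Omega> s (x, \<not> b) (letter_act \<Omega> s (x, b) z) = z" if "x \<in> V" "z \<in> \<Omega>" for x b z
    using that bij[of x] by (auto simp: letter_act_def bij_betw_def f_inv_into_f)
  have eq: "(u, w) \<in> artin_eq V E m \<Longrightarrow> z \<in> \<Omega> \<Longrightarrow> ?run u z = ?run w z" for u w z
  proof (induction arbitrary: z rule: artin_eq.induct)
    case (rel u w x y)
    then show ?case using rels[of x y "?run u z"] run[of u z] by simp
  qed (auto simp: run undo)
  define r where "r = (\<lambda>A. ?run (SOME w. w \<in> A))"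
  have r: "r (cl V E m w) z = ?run w z" if "w \<in> words_on V" "z \<in> \<Omega>" for w z
  proof -
    have "w \<in> cl V E m w" using that by (auto simp: cl_def intro: artin_eq.refl)
    then have "(SOME u. u \<in> cl V E m w) \<in> cl V E m w" by (rule someI)
    then show ?thesis using eq[of w _ z] that by (simp add: r_def cl_def)
  qed
  show thesis
  proof
    show "right_action (artin_group V E m) \<Omega> r"
      unfolding right_action_def
      by (auto simp: carrier_artin one_artin mult_artin r run)
    show "r (gen x) z = s x z" if "x \<in> V" "z \<in> \<Omega>" for x z
      using that by (simp add: gen_def r letter_act_def)
  qed
qed

lemma run_alt_word:
  "fold (letter_act \<Omega> s) (alt_word x y (2 * k)) = (s y \<circ> s x) ^^ k"
proof (induction k)
  case (Suc k)
  then show ?case by (simp add: letter_act_def funpow_Suc_right del: funpow.simps)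
qed auto

end

section \<open>Free quotients\<close>

lemma eval_word_Nil [simp]: "eval_word G [] = \<one>\<^bsub>G\<^esub>"
  by (simp add: eval_word_def)

lemma eval_word_Cons [simp]:
  "eval_word G ((x, b) # w) = (if b then x else inv\<^bsub>G\<^esub> x) \<otimes>\<^bsub>G\<^esub> eval_word G w"
  by (simp add: eval_word_def)

lemma (in group) eval_word_closed:
  "fst ` set w \<subseteq> carrier G \<Longrightarrow> eval_word G w \<in> carrier G"
  by (induction w) auto

lemma (in group) eval_word_append:
  "fst ` set u \<subseteq> carrier G \<Longrightarrow> fst ` set w \<subseteq> carrier G \<Longrightarrow>
     eval_word G (u @ w) = eval_word G u \<otimes> eval_word G w"
  by (induction u) (auto simp: eval_word_closed m_assoc)

lemma (in group_hom) hom_eval_word: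
  "fst ` set w \<subseteq> carrier G \<Longrightarrow> h (eval_word G w) = eval_word H (map (apfst h) w)"
  by (induction w) (auto simp: G.eval_word_closed)

lemma (in group) eval_word_restrict:
  assumes "subgroup H G"
  shows "fst ` set w \<subseteq> H \<Longrightarrow> eval_word (G\<lparr>carrier := H\<rparr>) w = eval_word G w"
  by (induction w) (auto simp: m_inv_consistent[OF assms])

lemma (in group) generate_eval_word:
  assumes "S \<subseteq> carrier G" and "g \<in> generate G S"
  shows "\<exists>w. fst ` set w \<subseteq> S \<and> eval_word G w = g"
  using assms(2)
proof induction
  case one
  show ?case by (rule exI[of _ "[]"]) simp
next
  case (incl h)
  then show ?case using assms(1) by (intro exI[of _ "[(h, True)]"]) auto
next
  case (inv h)
  then show ?case using assms(1) by (intro exI[of _ "[(h, False)]"]) auto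
next
  case (eng g h)
  then obtain u w where "fst ` set u \<subseteq> S" "eval_word G u = g" "fst ` set w \<subseteq> S" "eval_word G w = h"
    by blast
  then show ?case using assms(1) by (intro exI[of _ "u @ w"]) (auto simp: eval_word_append)
qed

lemma reduced_word_map:
  "inj_on f (fst ` set w) \<Longrightarrow> reduced_word (map (apfst f) w) \<longleftrightarrow> reduced_word w"
proof (induction w rule: reduced_word.induct)
  case (1 x y ws)
  have "f (fst x) = f (fst y) \<longleftrightarrow> fst x = fst y" using "1.prems" by (auto dest: inj_onD)
  moreover have "reduced_word (map (apfst f) (y # ws)) \<longleftrightarrow> reduced_word (y # ws)"
    using 1 by (cases "fst x = fst y \<and> snd x \<noteq> snd y") (auto intro: inj_on_subset)
  ultimately show ?case by simp
qed auto

text \<open>The basis consists of the cosets of the \<open>D i\<close>: \<open>span\<close> makes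
  them generate, \<open>indep\<close> keeps reduced words out of K.\<close>

lemma (in group) free_group_quotient:
  assumes K: "K \<lhd> G" and H: "subgroup H G" and KH: "K \<subseteq> H"
    and D: "D ` I \<subseteq> H"
    and span: "H \<subseteq> K <#>\<^bsub>G\<^esub> generate G (D ` I)"
    and indep: "\<And>w. fst ` set w \<subseteq> I \<Longrightarrow> reduced_word w \<Longrightarrow> w \<noteq> [] \<Longrightarrow> eval_word G (map (apfst D) w) \<notin> K"
  shows "free_group ((G\<lparr>carrier := H\<rparr>) Mod K)"
proof -
  let ?H = "G\<lparr>carrier := H\<rparr>"
  let ?Q = "?H Mod K" and ?\<pi> = "\<lambda>x. K #>\<^bsub>?H\<^esub> x"
  have N: "K \<lhd> ?H" using normal_restrict_supergroup[OF H K KH] .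
  interpret Q: group_hom ?H ?Q ?\<pi>
    using normal.r_coset_hom_Mod[OF N] normal.factorgroup_is_group[OF N] subgroup.subgroup_is_group[OF H is_group]
    by (simp add: group_hom_def group_hom_axioms_def)
  have HG: "H \<subseteq> carrier G" using H subgroup.subset by blast
  have DG: "D ` I \<subseteq> carrier G" using D HG by blast
  have Ks: "subgroup K ?H" using N by (rule normal_imp_subgroup)
  have hom: "?\<pi> (eval_word G w) = eval_word ?Q (map (apfst ?\<pi>) w)" if "fst ` set w \<subseteq> H" for w
    using Q.hom_eval_word[of w] that by (simp add: eval_word_restrict[OF H])
  let ?S = "?\<pi> ` D ` I"
  have 1: "\<exists>w. set (map fst w) \<subseteq> ?S \<and> eval_word ?Q w = g" if "g \<in> carrier ?Q" for g
  proof -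
    from that obtain x where x: "x \<in> H" "g = ?\<pi> x"
      by (auto simp: FactGroup_def RCOSETS_def)
    with span obtain \<kappa> y where \<kappa>: "\<kappa> \<in> K" "y \<in> generate G (D ` I)" "x = \<kappa> \<otimes> y"
      by (auto simp: set_mult_def)
    obtain w where w: "fst ` set w \<subseteq> D ` I" "eval_word G w = y"
      using generate_eval_word[OF DG \<kappa>(2)] by blast
    have yH: "y \<in> H" using generate_subgroup_incl[OF D H] \<kappa> by blast
    have "?\<pi> x = (K #>\<^bsub>?H\<^esub> \<kappa>) #>\<^bsub>?H\<^esub> y"
      using \<kappa> yH KH Q.G.coset_mult_assoc[of K \<kappa> y] by auto
    also have "K #>\<^bsub>?H\<^esub> \<kappa> = K" using \<kappa> Ks Q.G.coset_join2[of \<kappa> K] KH by auto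
    finally have "g = eval_word ?Q (map (apfst ?\<pi>) w)" using x hom[of w] w D by auto
    moreover have "set (map fst (map (apfst ?\<pi>) w)) \<subseteq> ?S" using w by auto
    ultimately show ?thesis by blast
  qed
  have 2: "eval_word ?Q w \<noteq> \<one>\<^bsub>?Q\<^esub>"
    if w: "set (map fst w) \<subseteq> ?S" "reduced_word w" "w \<noteq> []" for w
  proof
    assume 1: "eval_word ?Q w = \<one>\<^bsub>?Q\<^esub>"
    \<comment> \<open>An index for each basis coset. It is injective, since the coset is recovered
      from its index, so reduced words over cosets lift to reduced words over I.\<close>
    define \<iota> where "\<iota> c = (SOME i. i \<in> I \<and> ?\<pi> (D i) = c)" for c
    have \<iota>: "\<iota> c \<in> I \<and> ?\<pi> (D (\<iota> c)) = c" if "c \<in> ?S" for c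
      unfolding \<iota>_def by (rule someI_ex) (use that in auto)
    have "inj_on \<iota> (fst ` set w)" using \<iota> w(1) by (intro inj_onI) (metis image_set subsetD)
    then have red: "reduced_word (map (apfst \<iota>) w)" using w(2) by (simp add: reduced_word_map)
    let ?w = "map (apfst D) (map (apfst \<iota>) w)"
    have I: "fst ` set (map (apfst \<iota>) w) \<subseteq> I" using \<iota> w(1) by auto
    then have g: "eval_word G ?w \<notin> K" using indep red w(3) by blast
    have wH: "fst ` set ?w \<subseteq> H" using I D by (auto simp: image_subset_iff)
    have "map (apfst ?\<pi>) ?w = w" using \<iota> w(1) by (auto simp: map_idI image_subset_iff intro!: map_idI)
    then have "?\<pi> (eval_word G ?w) = K" using hom[OF wH] 1 by (simp add: FactGroup_def)
    moreover have "eval_word G ?w \<in> H"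
      using wH Q.G.eval_word_closed[of ?w] by (simp add: eval_word_restrict[OF H])
    ultimately show False using g Q.G.rcos_self[of "eval_word G ?w" K] Ks by auto
  qed
  have 3: "?S \<subseteq> carrier ?Q" using D Q.hom_closed by auto
  show ?thesis unfolding free_group_def
    by (intro conjI exI[of _ ?S] ballI allI impI) (use 1 2 3 Q.H.is_group in simp_all)
qed

text \<open>The free group on 'i acting on its reduced words; the words that are not reduced are
  fixed only to make the maps total.\<close>

definition push :: "'i \<times> bool \<Rightarrow> ('i \<times> bool) list \<Rightarrow> ('i \<times> bool) list" where
  "push l v = (if reduced_word v then
     (case v of [] \<Rightarrow> [l] | l' # v' \<Rightarrow> if fst l' = fst l \<and> snd l' \<noteq> snd l then v' else l # v) else v)"

lemma reduced_word_ConsD: "reduced_word (l # v) \<Longrightarrow> reduced_word v"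
  by (cases v) auto

lemma push_push: "push (x, \<not> b) (push (x, b) v) = v"
  by (cases v rule: reduced_word.cases) (auto simp: push_def dest: reduced_word_ConsD split: list.splits)

lemma push_Bij: "push l \<in> carrier (BijGroup UNIV)"
proof -
  obtain x b where l: "l = (x, b)" by force
  have "bij (push l)"
    by (rule o_bij[of "push (x, \<not> b)"]) (use push_push[of x b] push_push[of x "\<not> b"] in \<open>auto simp: l\<close>)
  then show ?thesis by (simp add: BijGroup_def Bij_def)
qed

lemma mult_Bij: "f \<in> carrier (BijGroup UNIV) \<Longrightarrow> g \<in> carrier (BijGroup UNIV) \<Longrightarrow> f \<otimes>\<^bsub>BijGroup UNIV\<^esub> g = f \<circ> g"
  by (auto simp: BijGroup_def compose_def fun_eq_iff)

lemma one_Bij: "\<one>\<^bsub>BijGroup UNIV\<^esub> = id"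
  by (auto simp: BijGroup_def)

lemma inv_push: "inv\<^bsub>BijGroup UNIV\<^esub> (push (x, True)) = push (x, False)"
proof -
  interpret group "BijGroup UNIV" by (rule group_BijGroup)
  show ?thesis
    using push_push[of x True]
    by (intro inv_equality) (auto simp: push_Bij mult_Bij one_Bij)
qed

text \<open>The letters of a reduced word are pushed from its right end without any cancellation.
  Hence only the empty one acts as the identity, which is the freeness of the permutations
  \<open>push (i, True)\<close>.\<close>

lemma eval_word_push:
  "reduced_word w \<Longrightarrow> eval_word (BijGroup UNIV) (map (apfst (\<lambda>i. push (i, True))) w) [] = w"
proof (induction w)
  case Nil
  then show ?case by (simp add: one_Bij)
next
  case (Cons l w)
  obtain x b where l: "l = (x, b)" by force
  interpret group "BijGroup (UNIV :: ('a \<times> bool) list set)" by (rule group_BijGroup)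
  let ?e = "eval_word (BijGroup UNIV) (map (apfst (\<lambda>i. push (i, True))) w)"
  have e: "?e \<in> carrier (BijGroup UNIV)" by (rule eval_word_closed) (auto simp: push_Bij)
  have "eval_word (BijGroup UNIV) (map (apfst (\<lambda>i. push (i, True))) (l # w)) = push l \<circ> ?e"
    using mult_Bij[OF push_Bij[of l] e] by (cases b) (simp_all add: l inv_push)
  moreover have "?e [] = w" using Cons reduced_word_ConsD by blast
  moreover have "push l w = l # w" using Cons.prems reduced_word_ConsD[OF Cons.prems]
    by (cases w) (auto simp: push_def)
  ultimately show ?case by simp
qed

section \<open>Kernels of actions, Schreier generators and a criterion for freeness\<close>

definition kernel_on :: "('a, 'b) monoid_scheme \<Rightarrow> 's set \<Rightarrow> ('a \<Rightarrow> 's \<Rightarrow> 's) \<Rightarrow> 'a set" where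
  "kernel_on G \<Omega> r = {g \<in> carrier G. \<forall>s \<in> \<Omega>. r g s = s}"

context group
begin

lemma inv_mult_cancel: "x \<in> carrier G \<Longrightarrow> y \<in> carrier G \<Longrightarrow> inv x \<otimes> (x \<otimes> y) = y"
  by (simp flip: m_assoc)

lemma cancel_inv: "x \<in> carrier G \<Longrightarrow> y \<in> carrier G \<Longrightarrow> x \<otimes> (inv x \<otimes> y) = y"
  by (simp flip: m_assoc)

context
  fixes \<Omega> :: "'s set" and r :: "'a \<Rightarrow> 's \<Rightarrow> 's"
  assumes act: "right_action G \<Omega> r"
begin

lemma act_in: "g \<in> carrier G \<Longrightarrow> s \<in> \<Omega> \<Longrightarrow> r g s \<in> \<Omega>"
  and act_one: "s \<in> \<Omega> \<Longrightarrow> r \<one> s = s"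
  and act_mult: "g \<in> carrier G \<Longrightarrow> h \<in> carrier G \<Longrightarrow> s \<in> \<Omega> \<Longrightarrow> r (g \<otimes> h) s = r h (r g s)"
  using act by (auto simp: right_action_def)

lemma act_inv: "g \<in> carrier G \<Longrightarrow> s \<in> \<Omega> \<Longrightarrow> r (inv g) (r g s) = s"
  using act_mult[of g "inv g" s] act_one by simp

lemma act_inv': "g \<in> carrier G \<Longrightarrow> s \<in> \<Omega> \<Longrightarrow> r g (r (inv g) s) = s"
  using act_mult[of "inv g" g s] act_one by simp

lemma kernel_subgroup: "subgroup (kernel_on G \<Omega> r) G"
proof (rule subgroupI)
  have "\<one> \<in> kernel_on G \<Omega> r" by (simp add: kernel_on_def act_one)
  then show "kernel_on G \<Omega> r \<noteq> {}" by blast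
  show "inv g \<in> kernel_on G \<Omega> r" if "g \<in> kernel_on G \<Omega> r" for g
    using that act_inv[of g] by (auto simp: kernel_on_def)
qed (auto simp: kernel_on_def act_mult)

lemma kernel_normal: "kernel_on G \<Omega> r \<lhd> G"
proof -
  have "g \<otimes> h \<otimes> inv g \<in> kernel_on G \<Omega> r" if "g \<in> carrier G" "h \<in> kernel_on G \<Omega> r" for g h
    using that act_inv[of g] by (auto simp: kernel_on_def act_mult act_in)
  then show ?thesis using kernel_subgroup by (simp add: normal_inv_iff)
qed

text \<open>Schreier rewriting with w as transversal: the element for g h at p is the one for g at p
  times the one for h at the image of p under g.\<close>

lemma generate_cocycle:
  assumes N: "subgroup N G" and S: "S \<subseteq> carrier G" and w: "\<And>p. p \<in> \<Omega> \<Longrightarrow> w p \<in> carrier G"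
    and gens: "\<And>v p. v \<in> S \<Longrightarrow> p \<in> \<Omega> \<Longrightarrow> w p \<otimes> v \<otimes> inv (w (r v p)) \<in> N"
    and g: "g \<in> generate G S"
  shows "p \<in> \<Omega> \<Longrightarrow> w p \<otimes> g \<otimes> inv (w (r g p)) \<in> N"
  using g
proof (induction arbitrary: p)
  case one
  then show ?case using N subgroup.one_closed w by (auto simp: act_one)
next
  case (incl v)
  then show ?case using gens by blast
next
  case (inv v)
  have v: "v \<in> carrier G" using inv S by blast
  let ?p = "r (inv v) p"
  have p: "?p \<in> \<Omega>" using inv v act_in by simp
  have rv: "r v ?p = p" by (rule act_inv'[OF v inv(2)])
  have wp: "w p \<in> carrier G" "w ?p \<in> carrier G" using w p inv(2) by auto
  have "inv (w ?p \<otimes> v \<otimes> inv (w p)) \<in> N"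
    using subgroup.m_inv_closed[OF N gens[OF inv(1) p]] by (simp only: rv)
  moreover have "inv (w ?p \<otimes> v \<otimes> inv (w p)) = w p \<otimes> inv v \<otimes> inv (w ?p)"
    using v wp by (simp add: inv_mult_group m_assoc)
  ultimately show ?case by simp
next
  case (eng g h)
  have gh: "g \<in> carrier G" "h \<in> carrier G" using eng(1,2) generate_in_carrier[OF S] by auto
  let ?p = "r g p"
  have p: "?p \<in> \<Omega>" using eng.prems gh act_in by simp
  have p2: "r h ?p \<in> \<Omega>" using p gh act_in by simp
  have wp: "w p \<in> carrier G" "w ?p \<in> carrier G" "w (r h ?p) \<in> carrier G"
    using w eng.prems p p2 by auto
  have rgh: "r (g \<otimes> h) p = r h ?p" by (rule act_mult[OF gh eng.prems])
  have "(w p \<otimes> g \<otimes> inv (w ?p)) \<otimes> (w ?p \<otimes> h \<otimes> inv (w (r h ?p))) \<in> N"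
    by (rule subgroup.m_closed[OF N eng.IH(1)[OF eng.prems] eng.IH(2)[OF p]])
  moreover have "(w p \<otimes> g \<otimes> inv (w ?p)) \<otimes> (w ?p \<otimes> h \<otimes> inv (w (r h ?p))) =
      w p \<otimes> (g \<otimes> h) \<otimes> inv (w (r h ?p))"
    using gh wp by (simp add: m_assoc inv_mult_cancel)
  ultimately show ?case by (simp add: rgh)
qed

end

text \<open>At the base point, where w is trivial, the Schreier element of a kernel element is that
  element itself.\<close>

lemma kernel_subset:
  assumes act: "right_action G E r" and N: "subgroup N G"
    and S: "carrier G = generate G S" "S \<subseteq> carrier G"
    and w: "\<And>p. p \<in> E \<Longrightarrow> w p \<in> carrier G" and pt: "pt \<in> E" "w pt = \<one>"
    and gens: "\<And>v p. v \<in> S \<Longrightarrow> p \<in> E \<Longrightarrow> w p \<otimes> v \<otimes> inv (w (r v p)) \<in> N"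
  shows "kernel_on G E r \<subseteq> N"
proof
  fix g assume g: "g \<in> kernel_on G E r"
  have "w pt \<otimes> g \<otimes> inv (w (r g pt)) \<in> N"
    using generate_cocycle[OF act N S(2) w gens _ pt(1), of g] g S(1) by (auto simp: kernel_on_def)
  then show "g \<in> N" using g pt by (auto simp: kernel_on_def)
qed

text \<open>Two actions share the work. The first one defines the kernel, and its Schreier elements
  give generation modulo K. The second one is trivial on K and lets \<open>D i\<close> multiply by
  the letter i over \<open>qt\<close>, so a nonempty reduced word in the \<open>D i\<close> moves
  the identity over \<open>qt\<close>.\<close>

lemma free_level:
  fixes I :: "'i set" and E :: "'s set" and E' :: "'t set"
  defines "B \<equiv> BijGroup (UNIV :: ('i \<times> bool) list set)"
  assumes K: "K \<lhd> G" and act: "right_action G E r" and KE: "K \<subseteq> kernel_on G E r"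
    and S: "carrier G = generate G S" "S \<subseteq> carrier G"
    and w: "\<And>p. p \<in> E \<Longrightarrow> w p \<in> carrier G" and pt: "pt \<in> E" "w pt = \<one>"
    and D: "D ` I \<subseteq> kernel_on G E r"
    and span: "\<And>v p. v \<in> S \<Longrightarrow> p \<in> E \<Longrightarrow> w p \<otimes> v \<otimes> inv (w (r v p)) \<in> K <#> generate G (D ` I)"
    and act': "right_action G (carrier B \<times> E') r'"  and qt: "qt \<in> E'"
    and K': "K \<subseteq> kernel_on G (carrier B \<times> E') r'"
    and D': "\<And>i g. i \<in> I \<Longrightarrow> g \<in> carrier B \<Longrightarrow> r' (D i) (g, qt) = (g \<otimes>\<^bsub>B\<^esub> push (i, True), qt)"
  shows "free_group ((G\<lparr>carrier := kernel_on G E r\<rparr>) Mod K)"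
proof (rule free_group_quotient[OF K kernel_subgroup[OF act] KE D])
  have DG: "D ` I \<subseteq> carrier G" using D by (auto simp: kernel_on_def)
  have N: "subgroup (K <#> generate G (D ` I)) G"
    using mult_norm_subgroup[OF K generate_is_subgroup[OF DG]] .
  show "kernel_on G E r \<subseteq> K <#> generate G (D ` I)"
    by (rule kernel_subset[OF act N S w pt span])
  interpret B: group B unfolding B_def by (rule group_BijGroup)
  let ?f = "\<lambda>i. push (i, True)"
  have f: "?f i \<in> carrier B" for i unfolding B_def by (rule push_Bij)
  fix u :: "('i \<times> bool) list" assume u: "fst ` set u \<subseteq> I" "reduced_word u" "u \<noteq> []"
  have fin: "fst ` set (map (apfst ?f) v) \<subseteq> carrier B" for v :: "('i \<times> bool) list" using f by auto
  have D_inv: "r' (inv (D i)) (g, qt) = (g \<otimes>\<^bsub>B\<^esub> inv\<^bsub>B\<^esub> ?f i, qt)" if "i \<in> I" "g \<in> carrier B" for i g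
  proof -
    have "r' (D i) (g \<otimes>\<^bsub>B\<^esub> inv\<^bsub>B\<^esub> ?f i, qt) = (g, qt)"
      using that f[of i] by (simp add: D' B.m_assoc)
    moreover have "D i \<in> carrier G" using that DG by blast
    ultimately show ?thesis
      using act_inv[OF act', of "D i" "(g \<otimes>\<^bsub>B\<^esub> inv\<^bsub>B\<^esub> ?f i, qt)"] that f[of i] qt by simp
  qed
  have "fst ` set v \<subseteq> I \<Longrightarrow> g \<in> carrier B \<Longrightarrow>
      r' (eval_word G (map (apfst D) v)) (g, qt) = (g \<otimes>\<^bsub>B\<^esub> eval_word B (map (apfst ?f) v), qt)" for v g
  proof (induction v arbitrary: g)
    case Nil
    then show ?case using act_one[OF act'] qt by simp
  next
    case (Cons l v)
    obtain i b where l: "l = (i, b)" by force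
    have i: "i \<in> I" "D i \<in> carrier G" using Cons.prems l DG by auto
    have v: "eval_word G (map (apfst D) v) \<in> carrier G"
      using Cons.prems DG by (intro eval_word_closed) (auto simp: image_subset_iff)
    show ?case using Cons i v f[of i] qt B.eval_word_closed[OF fin[of v]]
      by (cases b) (simp_all add: l act_mult[OF act'] D' D_inv B.m_assoc)
  qed
  from this[OF u(1) B.one_closed] have "r' (eval_word G (map (apfst D) u)) (\<one>\<^bsub>B\<^esub>, qt) =
     (eval_word B (map (apfst ?f) u), qt)"
    using B.eval_word_closed[OF fin[of u]] by simp
  moreover have "eval_word B (map (apfst ?f) u) \<noteq> \<one>\<^bsub>B\<^esub>"
    using eval_word_push[OF u(2)] u(3) unfolding B_def one_Bij by auto
  ultimately show "eval_word G (map (apfst D) u) \<notin> K"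
    using K' qt B.one_closed by (fastforce simp: kernel_on_def)
qed

end

section \<open>Group elements along the Cayley graph\<close>

lemma node_induct:
  assumes u: "u \<in> nodes m"
    and base: "P ([], 0)"
    and right: "\<And>rs j. (rs, j) \<in> nodes m \<Longrightarrow> P (rs, j) \<Longrightarrow> P (rs, j + 1)"
    and left: "\<And>rs j. (rs, j) \<in> nodes m \<Longrightarrow> P (rs, j + 1) \<Longrightarrow> P (rs, j)"
    and toggle: "\<And>u. u \<in> nodes m \<Longrightarrow> P u \<Longrightarrow> P (toggle m u)"
  shows "P u"
proof -
  have along: "P (rs, j)" if rs: "(rs, 0) \<in> nodes m" and i: "P (rs, i)" for rs i j
  proof (induction j rule: int_induct[where k = i])
    case (step1 j)
    then show ?case using right rs by (simp add: nodes_def)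
  next
    case (step2 j)
    then show ?case using left[of rs "j - 1"] rs by (simp add: nodes_def)
  qed (rule i)
  have "(rs, j) \<in> nodes m \<Longrightarrow> P (rs, j)" for rs j
  proof (induction rs arbitrary: j)
    case Nil
    then show ?case using along[of "[]" 0] base by (simp add: nodes_def)
  next
    case (Cons h rs)
    \<comment> \<open>The zigzag \<open>h # rs\<close> is entered at index h, which is its own
      residue.\<close>
    have "(rs, h) \<in> nodes m" using Cons.prems by (auto simp: nodes_def dest: distinct_adj_ConsD)
    moreover have "toggle m (rs, h) = (h # rs, h)"
      using Cons.prems by (cases rs) (auto simp: nodes_def)
    ultimately have "P (h # rs, h)" using toggle Cons.IH by metis
    then show ?case using along[of "h # rs" h] Cons.prems by (simp add: nodes_def)
  qed
  then show ?thesis using u by (cases u) simp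
qed

definition points :: "int \<Rightarrow> node set" where
  "points m = {u \<in> nodes m. evn u}"

text \<open>The b-step on even descriptions: pass to the odd one and advance. The result is even
  again, so no second toggle occurs.\<close>

definition btau :: "int \<Rightarrow> node \<Rightarrow> node" where
  "btau m u = (fst (toggle m u), snd u + 1)"

lemma points_nodes: "u \<in> points m \<Longrightarrow> u \<in> nodes m"
  by (simp add: points_def)

lemma tau_points: "u \<in> points m \<Longrightarrow> tau m u \<in> points m"
  by (simp add: points_def tau_in evn_tau)

lemma btau_toggle: "u \<in> nodes m \<Longrightarrow> btau m (toggle m u) = toggle m (tau m u)"
  by (simp add: btau_def tau_def toggle_toggle nodes_def)

lemma btau_points: "u \<in> points m \<Longrightarrow> btau m u \<in> points m"
  using toggle_in[of u m] evn_toggle[of m u]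
  by (auto simp: points_def btau_def nodes_def) (auto simp: evn_def)

lemma bij_tau: "bij_betw (tau m) (points m) (points m)"
proof (rule bij_betw_byWitness[where f' = "tau' m"])
  have "tau' m u \<in> points m" if "u \<in> points m" for u
    using that evn_tau[of m "tau' m u"] by (simp add: points_def tau'_in tau_tau')
  then show "tau' m ` points m \<subseteq> points m" by blast
qed (use tau'_tau tau_tau' tau_points in \<open>auto simp: points_nodes\<close>)

lemma bij_btau: "bij_betw (btau m) (points m) (points m)"
proof (rule bij_betw_byWitness[where f' = "\<lambda>u. toggle m (fst u, snd u - 1)"])
  have in_nodes: "(fst u, snd u - 1) \<in> nodes m" if "u \<in> points m" for u
    using that by (simp add: points_def nodes_def)
  show "\<forall>u\<in>points m. toggle m (fst (btau m u), snd (btau m u) - 1) = u"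
    using toggle_toggle by (auto simp: btau_def points_def) (metis prod.collapse snd_conv snd_toggle)
  show "\<forall>u\<in>points m. btau m (toggle m (fst u, snd u - 1)) = u"
    using toggle_toggle[OF in_nodes] by (simp add: btau_def)
  show "(\<lambda>u. toggle m (fst u, snd u - 1)) ` points m \<subseteq> points m"
    using toggle_in[OF in_nodes] by (auto simp: points_def evn_toggle) (auto simp: evn_def)
qed (use btau_points in blast)

lemma tau_funpow_in: "u \<in> nodes m \<Longrightarrow> (tau m ^^ i) u \<in> nodes m"
  by (induction i) (auto simp: tau_in)

lemma btau_funpow: "u \<in> nodes m \<Longrightarrow> (btau m ^^ i) (toggle m u) = toggle m ((tau m ^^ i) u)"
  by (induction i) (auto simp: btau_toggle tau_funpow_in)

text \<open>One side follows the zigzag of the even description, the other that of the odd one.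
  These zigzags share a full class of indices modulo 2 * k, so after 2 * k steps from a common
  vertex they meet again.\<close>

lemma points_relation:
  assumes u: "u \<in> points (2 * int k)"
  shows "((btau (2 * int k) \<circ> tau (2 * int k)) ^^ k) u = ((tau (2 * int k) \<circ> btau (2 * int k)) ^^ k) u"
proof -
  let ?m = "2 * int k"
  have n: "u \<in> nodes ?m" "toggle ?m u \<in> nodes ?m" using u toggle_in by (auto simp: points_def)
  have 1: "((btau ?m \<circ> tau ?m) ^^ i) u = (fst u, snd u + 2 * int i)" for i
  proof (induction i)
    case (Suc i)
    have "(fst u, snd u + 2 * int i + 1) \<in> nodes ?m" using n by (simp add: nodes_def)
    then show ?case using Suc toggle_toggle[of "(fst u, snd u + 2 * int i + 1)" ?m]
      by (simp add: btau_def tau_def)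
  qed simp
  have 2: "((tau ?m \<circ> btau ?m) ^^ i) u = toggle ?m (fst (toggle ?m u), snd u + 2 * int i)" for i
  proof (induction i)
    case 0
    then show ?case using toggle_toggle[OF n(1)] by (metis funpow_0 mult_zero_right of_nat_0 add_0_right prod.collapse snd_toggle)
  next
    case (Suc i)
    have "(fst (toggle ?m u), snd u + 2 * int i) \<in> nodes ?m" using n(2) by (simp add: nodes_def)
    then show ?case using Suc toggle_toggle[of "(fst (toggle ?m u), snd u + 2 * int i)" ?m]
      by (simp add: btau_def tau_def algebra_simps)
  qed
  have "toggle ?m (fst (toggle ?m u), snd u + ?m) = (fst u, snd u + ?m)"
  proof (cases "(?m, u)" rule: toggle.cases)
    case (2 m' h rs j)
    with n(1) show ?thesis by (cases rs) (auto simp: nodes_def)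
  qed auto
  then show ?thesis using 1 2 by simp
qed

section \<open>Evaluation of nodes in a group satisfying the dihedral relation\<close>

definition alt :: "('a, 'b) monoid_scheme \<Rightarrow> 'a \<Rightarrow> 'a \<Rightarrow> int \<Rightarrow> 'a" where
  "alt G x y j = (x \<otimes>\<^bsub>G\<^esub> y) [^]\<^bsub>G\<^esub> (j div 2) \<otimes>\<^bsub>G\<^esub> (if odd j then x else \<one>\<^bsub>G\<^esub>)"

text \<open>\<open>alt G x y j\<close> multiplies j letters of x y x y ..., going backwards with
  inverses for negative j. The depth t decides the first letter, so that x follows even nodes and y
  follows odd ones.\<close>

definition path :: "('a, 'b) monoid_scheme \<Rightarrow> 'a \<Rightarrow> 'a \<Rightarrow> nat \<Rightarrow> int \<Rightarrow> 'a" where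
  "path G x y t j = (if even t then alt G x y j else alt G y x j)"

text \<open>The element at index 0 of a zigzag, adjusted so that this zigzag and its parent give the
  same element at the shared index h.\<close>

primrec prefix :: "('a, 'b) monoid_scheme \<Rightarrow> 'a \<Rightarrow> 'a \<Rightarrow> int list \<Rightarrow> 'a" where
  "prefix G x y [] = \<one>\<^bsub>G\<^esub>"
| "prefix G x y (h # rs) = prefix G x y rs \<otimes>\<^bsub>G\<^esub> path G x y (length rs) h
     \<otimes>\<^bsub>G\<^esub> inv\<^bsub>G\<^esub> (path G x y (Suc (length rs)) h)"

text \<open>The element of the dihedral subgroup at a vertex of its Cayley graph, read off along the path
  from the root.\<close>

definition node_elt :: "('a, 'b) monoid_scheme \<Rightarrow> 'a \<Rightarrow> 'a \<Rightarrow> node \<Rightarrow> 'a" where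
  "node_elt G x y u = prefix G x y (fst u) \<otimes>\<^bsub>G\<^esub> path G x y (length (fst u)) (snd u)"

definition node_conj :: "('a, 'b) monoid_scheme \<Rightarrow> 'a \<Rightarrow> 'a \<Rightarrow> 'a \<Rightarrow> node \<Rightarrow> 'a" where
  "node_conj G x y z u = node_elt G x y u \<otimes>\<^bsub>G\<^esub> z \<otimes>\<^bsub>G\<^esub> inv\<^bsub>G\<^esub> (node_elt G x y u)"

context group
begin

lemma pow_mult_swap:
  assumes "u \<in> carrier G" "v \<in> carrier G"
  shows "(u \<otimes> v) [^] (i::nat) \<otimes> u = u \<otimes> (v \<otimes> u) [^] i"
proof (induction i)
  case (Suc i)
  have "(u \<otimes> v) [^] Suc i \<otimes> u = ((u \<otimes> v) [^] i \<otimes> u) \<otimes> (v \<otimes> u)" using assms by (simp add: m_assoc)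
  then show ?case unfolding Suc using assms by (simp add: m_assoc)
qed (use assms in simp)

lemma commuting_subgroup:
  assumes c: "c \<in> carrier G" shows "subgroup {g \<in> carrier G. c \<otimes> g = g \<otimes> c} G"
proof (rule subgroupI)
  fix g assume "g \<in> {g \<in> carrier G. c \<otimes> g = g \<otimes> c}"
  then have g: "g \<in> carrier G" "c \<otimes> g = g \<otimes> c" by auto
  have "inv g \<otimes> c = inv g \<otimes> (c \<otimes> g) \<otimes> inv g" using g(1) c by (simp add: m_assoc)
  also have "\<dots> = c \<otimes> inv g" unfolding g(2) using g(1) c by (simp flip: m_assoc)
  finally show "inv g \<in> {g \<in> carrier G. c \<otimes> g = g \<otimes> c}" using g(1) by simp
next
  fix g h assume "g \<in> {g \<in> carrier G. c \<otimes> g = g \<otimes> c}" "h \<in> {g \<in> carrier G. c \<otimes> g = g \<otimes> c}"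
  then have g: "g \<in> carrier G" "c \<otimes> g = g \<otimes> c" and h: "h \<in> carrier G" "c \<otimes> h = h \<otimes> c" by auto
  have "c \<otimes> (g \<otimes> h) = (c \<otimes> g) \<otimes> h" using g(1) h(1) c by (simp add: m_assoc)
  also have "\<dots> = g \<otimes> (c \<otimes> h)" unfolding g(2) using g(1) h(1) c by (simp add: m_assoc)
  finally show "g \<otimes> h \<in> {g \<in> carrier G. c \<otimes> g = g \<otimes> c}" using g h c by (simp add: m_assoc)
qed (use c in \<open>auto intro: exI[of _ \<one>]\<close>)

lemma alt_closed: "x \<in> carrier G \<Longrightarrow> y \<in> carrier G \<Longrightarrow> alt G x y j \<in> carrier G"
  by (simp add: alt_def)

lemma alt_Suc:
  assumes "x \<in> carrier G" "y \<in> carrier G"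
  shows "alt G x y (j + 1) = alt G x y j \<otimes> (if even j then x else y)"
proof (cases "even j")
  case True
  then have "(j + 1) div 2 = j div 2" by presburger
  then show ?thesis using assms True by (simp add: alt_def)
next
  case False
  then have "(j + 1) div 2 = j div 2 + 1" by presburger
  then show ?thesis using assms False
    using int_pow_mult[of "x \<otimes> y" "j div 2" 1] by (simp add: alt_def m_assoc)
qed

lemma alt_period:
  assumes xy: "x \<in> carrier G" "y \<in> carrier G"
  shows "alt G x y (j + 2 * int k * q) = (x \<otimes> y) [^] (int k * q) \<otimes> alt G x y j"
proof -
  have "(j + 2 * int k * q) div 2 = int k * q + j div 2" "odd (j + 2 * int k * q) = odd j"
    by (simp_all add: mult.assoc)
  then show ?thesis using xy int_pow_mult[of "x \<otimes> y" "int k * q" "j div 2"]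
    by (simp add: alt_def m_assoc)
qed

context
  fixes x y k
  assumes xy: "x \<in> carrier G" "y \<in> carrier G" and rel: "(x \<otimes> y) [^] (k::nat) = (y \<otimes> x) [^] k"
begin

lemma path_closed: "path G x y t j \<in> carrier G"
  using xy by (simp add: path_def alt_closed)

lemma prefix_closed: "prefix G x y rs \<in> carrier G"
  by (induction rs) (auto simp: path_closed)

lemma node_elt_closed: "node_elt G x y u \<in> carrier G"
  by (simp add: node_elt_def path_closed prefix_closed)

lemma node_elt_Nil: "node_elt G x y ([], 0) = \<one>"
  using xy by (simp add: node_elt_def path_def alt_def)

lemma node_elt_Suc:
  "node_elt G x y (rs, j + 1) = node_elt G x y (rs, j) \<otimes> (if evn (rs, j) then x else y)"
  using xy path_closed[of "length rs" j] prefix_closed[of rs]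
  by (auto simp: node_elt_def path_def alt_Suc m_assoc evn_def)

lemma power_central:
  assumes "v \<in> {x, y}" shows "(x \<otimes> y) [^] k \<otimes> v = v \<otimes> (x \<otimes> y) [^] k"
  using pow_mult_swap[of x y k] pow_mult_swap[of y x k] xy rel assms by auto

text \<open>By the relation the k-th power of x y is central in the subgroup generated by x and y,
  so 2 * k * q further steps contribute the same power on either kind of path.\<close>

lemma path_period:
  "path G x y t (j + 2 * int k * q) = path G x y t j \<otimes> (x \<otimes> y) [^] (int k * q)"
proof -
  let ?z = "(x \<otimes> y) [^] k"
  have z: "?z \<in> carrier G" using xy by simp
  have zq: "(x \<otimes> y) [^] (int k * q) = ?z [^] q" "(y \<otimes> x) [^] (int k * q) = ?z [^] q" for q
    using xy rel by (simp_all add: int_pow_int flip: int_pow_pow)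
  define Z where "Z = {g \<in> carrier G. ?z \<otimes> g = g \<otimes> ?z}"
  have Z: "subgroup Z G" unfolding Z_def by (rule commuting_subgroup[OF z])
  have xyZ: "x \<in> Z" "y \<in> Z" using power_central xy by (auto simp: Z_def)
  have "path G x y t j \<in> Z"
    using subgroup.m_closed[OF Z] subgroup_int_pow_closed[OF Z] subgroup.one_closed[OF Z] xyZ
    by (simp add: path_def alt_def)
  then have p: "path G x y t j \<in> {g \<in> carrier G. ?z \<otimes> g = g \<otimes> ?z}" unfolding Z_def .
  have "path G x y t j \<otimes> ?z = ?z \<otimes> path G x y t j"
    by (rule CollectD[OF p, THEN conjunct2, symmetric])
  \<comment> \<open>The commutation is turned round: the powers of \<open>?z\<close> are now placed
    in the centralizer of the path element.\<close>
  then have zp: "?z \<in> {g \<in> carrier G. path G x y t j \<otimes> g = g \<otimes> path G x y t j}"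
    by (intro CollectI conjI z)
  have "?z [^] q \<otimes> path G x y t j = path G x y t j \<otimes> ?z [^] q"
    by (rule CollectD[OF subgroup_int_pow_closed[OF commuting_subgroup[OF path_closed] zp],
          THEN conjunct2, symmetric])
  moreover have "path G x y t (j + 2 * int k * q) = ?z [^] q \<otimes> path G x y t j"
    using alt_period[OF xy, of j k q] alt_period[OF xy(2,1), of j k q]
    unfolding zq path_def by (cases "even t") simp_all
  ultimately show ?thesis unfolding zq by (simp only:)
qed

text \<open>The two zigzags agree at the index h by the choice of \<open>prefix\<close>; going on to
  an index congruent to h multiplies both by the same central power.\<close>

lemma node_elt_toggle: "node_elt G x y (toggle (2 * int k) u) = node_elt G x y u"
proof -
  let ?m = "2 * int k"
  have push: "node_elt G x y (j mod ?m # rs, j) = node_elt G x y (rs, j)" for rs j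
  proof -
    let ?p = "path G x y (length rs)" and ?p' = "path G x y (Suc (length rs))"
    let ?h = "j mod ?m" and ?z = "(x \<otimes> y) [^] (int k * (j div ?m))"
    have z: "?z \<in> carrier G" using xy by simp
    have "j = ?h + ?m * (j div ?m)" by simp
    then have "?p j = ?p ?h \<otimes> ?z" "?p' j = ?p' ?h \<otimes> ?z"
      using path_period[of _ ?h "j div ?m"] by metis+
    then show ?thesis
      using z path_closed prefix_closed by (simp add: node_elt_def m_assoc inv_mult_cancel)
  qed
  show ?thesis by (cases "(?m, u)" rule: toggle.cases) (auto simp: push)
qed

lemma node_elt_tau: "node_elt G x y (tau (2 * int k) u) = node_elt G x y u \<otimes> (if evn u then x else y)"
  using node_elt_Suc[of "fst u" "snd u"] by (simp add: tau_def node_elt_toggle)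

lemma node_elt_btau: "\<not> evn (toggle (2 * int k) u) \<Longrightarrow>
    node_elt G x y (btau (2 * int k) u) = node_elt G x y u \<otimes> y"
  using node_elt_Suc[of "fst (toggle (2 * int k) u)" "snd u"] node_elt_toggle[of u]
  by (simp add: btau_def evn_def flip: node_elt_toggle[of u]) (metis node_elt_toggle prod.collapse snd_toggle)

end

text \<open>The product of M consecutive conjugates telescopes to w i (c x)^M w (i +
  M)^(-1).\<close>

lemma conj_is_line:
  fixes w :: "int \<Rightarrow> 'a"
  assumes w: "\<And>i. w i \<in> carrier G" and step: "\<And>i. w (i + 1) = w i \<otimes> x"
    and xc: "x \<in> carrier G" "c \<in> carrier G" and rel: "(x \<otimes> c) [^] N = (c \<otimes> x) [^] (N::nat)"
  shows "is_line G N (\<lambda>i. w i \<otimes> c \<otimes> inv (w i))"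
proof -
  let ?D = "\<lambda>i. w i \<otimes> c \<otimes> inv (w i)"
  have L: "lprod G (\<lambda>j. ?D (i + int j)) M = w i \<otimes> (c \<otimes> x) [^] M \<otimes> inv (w (i + int M))" for i M
  proof (induction M)
    case (Suc M)
    have s: "w (i + int (Suc M)) = w (i + int M) \<otimes> x" using step[of "i + int M"] by (simp add: ac_simps)
    have "lprod G (\<lambda>j. ?D (i + int j)) (Suc M) =
        w i \<otimes> (c \<otimes> x) [^] M \<otimes> inv (w (i + int M)) \<otimes> (w (i + int M) \<otimes> c \<otimes> inv (w (i + int M)))"
      using Suc by simp
    also have "\<dots> = w i \<otimes> (c \<otimes> x) [^] Suc M \<otimes> inv (w (i + int (Suc M)))"
      unfolding s using w xc by (simp add: m_assoc inv_mult_cancel inv_mult_group cancel_inv)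
    finally show ?case .
  qed (use w in simp)
  have "lprod G (\<lambda>j. ?D (i + int j)) N = lprod G (\<lambda>j. ?D (i + 1 + int j)) N" for i
  proof -
    have s2: "w (i + 1 + int N) = w (i + int N) \<otimes> x" using step[of "i + int N"] by (simp add: ac_simps)
    have "lprod G (\<lambda>j. ?D (i + 1 + int j)) N = w i \<otimes> (x \<otimes> (c \<otimes> x) [^] N) \<otimes> inv (w (i + int N) \<otimes> x)"
      unfolding L s2 step using w xc by (simp add: m_assoc)
    \<comment> \<open>x (c x)^N = (x c)^N x, which the relation turns into (c x)^N x; the last x
      cancels.\<close>
    also have "\<dots> = w i \<otimes> (c \<otimes> x) [^] N \<otimes> inv (w (i + int N))"
      unfolding pow_mult_swap[OF xc, symmetric] rel using w xc by (simp add: m_assoc inv_mult_group cancel_inv)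
    finally show ?thesis by (simp add: L)
  qed
  then show ?thesis using w xc by (simp add: is_line_def)
qed

end

section \<open>The three layers of the chain\<close>

lemma funpow_cocycle:
  assumes B: "group B" and t: "\<And>p. p \<in> E \<Longrightarrow> t p \<in> E" and C: "\<And>p. p \<in> E \<Longrightarrow> C p \<in> carrier B"
    and f: "f \<in> carrier B" and p: "p \<in> E"
  shows "(((\<lambda>(f, p). (f \<otimes>\<^bsub>B\<^esub> C p, p)) \<circ> (\<lambda>(f, p). (f, t p))) ^^ N) (f, p) =
      (f \<otimes>\<^bsub>B\<^esub> lprod B (\<lambda>j. C ((t ^^ Suc j) p)) N, (t ^^ N) p)" (is ?A)
    and "(((\<lambda>(f, p). (f, t p)) \<circ> (\<lambda>(f, p). (f \<otimes>\<^bsub>B\<^esub> C p, p))) ^^ N) (f, p) =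
      (f \<otimes>\<^bsub>B\<^esub> lprod B (\<lambda>j. C ((t ^^ j) p)) N, (t ^^ N) p)" (is ?B)
proof -
  interpret group B by (rule B)
  have tp: "(t ^^ i) p \<in> E" for i using p t by (induction i) auto
  have cl: "lprod B (\<lambda>j. C ((t ^^ Suc j) p)) i \<in> carrier B" "lprod B (\<lambda>j. C ((t ^^ j) p)) i \<in> carrier B" for i
    using C tp by (auto intro!: lprod_closed simp del: funpow.simps)
  show ?A using f cl(1) C tp by (induction N) (simp_all add: m_assoc t)
  show ?B using f cl(2) C tp by (induction N) (simp_all add: m_assoc)
qed

text \<open>After N rounds both sides have moved p by t^N and collected N consecutive values of C,
  starting at t p or at p. The dihedral relation thus amounts to the line condition.\<close>

lemma cocycle_relation:
  assumes "group B" and "\<And>p. p \<in> E \<Longrightarrow> t p \<in> E" and "\<And>p. p \<in> E \<Longrightarrow> C p \<in> carrier B"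
    and "f \<in> carrier B" and "p \<in> E"
    and "lprod B (\<lambda>j. C ((t ^^ j) p)) N = lprod B (\<lambda>j. C ((t ^^ Suc j) p)) N"
  shows "(((\<lambda>(f, p). (f \<otimes>\<^bsub>B\<^esub> C p, p)) \<circ> (\<lambda>(f, p). (f, t p))) ^^ N) (f, p) =
    (((\<lambda>(f, p). (f, t p)) \<circ> (\<lambda>(f, p). (f \<otimes>\<^bsub>B\<^esub> C p, p))) ^^ N) (f, p)"
proof -
  note eq = funpow_cocycle[of B E t C f p, OF assms(1-5), of N]
  show ?thesis using eq by (simp only: assms(6))
qed

lemma bij_betw_snd:
  assumes t: "bij_betw t E E"
  shows "bij_betw (\<lambda>(f, p). (f, t p)) (A \<times> E) (A \<times> E)"
  using bij_betw_map_prod[OF bij_betw_id[of A] t] by (simp add: map_prod_def id_def)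

lemma bij_betw_cocycle:
  assumes "group B" and C: "\<And>p. p \<in> E \<Longrightarrow> C p \<in> carrier B"
  shows "bij_betw (\<lambda>(f, p). (f \<otimes>\<^bsub>B\<^esub> C p, p)) (carrier B \<times> E) (carrier B \<times> E)"
proof -
  interpret group B by fact
  show ?thesis
    by (rule bij_betw_byWitness[where f' = "\<lambda>(f, p). (f \<otimes>\<^bsub>B\<^esub> inv\<^bsub>B\<^esub> (C p), p)"])
      (auto simp: C m_assoc)
qed

context group
begin

lemma subset_set_mult_generate:
  assumes "K \<lhd> G" "T \<subseteq> carrier G"
  shows "g \<in> K \<Longrightarrow> g \<in> K <#> generate G T" and "g \<in> generate G T \<Longrightarrow> g \<in> K <#> generate G T"
proof -
  have K: "subgroup K G" using assms(1) by (rule normal_imp_subgroup)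
  show "g \<in> K \<Longrightarrow> g \<in> K <#> generate G T"
    using subgroup.mem_carrier[OF K] generate.one[of G T] by (force simp: set_mult_def)
  show "g \<in> generate G T \<Longrightarrow> g \<in> K <#> generate G T"
    using generate_in_carrier[OF assms(2)] subgroup.one_closed[OF K] by (force simp: set_mult_def)
qed

lemma normal_conj: "N \<lhd> G \<Longrightarrow> g \<in> carrier G \<Longrightarrow> h \<in> N \<Longrightarrow> g \<otimes> h \<otimes> inv g \<in> N"
  by (simp add: normal_inv_iff)

lemma act_inj:
  assumes "right_action G \<Omega> r" "v \<in> carrier G" "s \<in> \<Omega>" "t \<in> \<Omega>" "r v s = r v t"
  shows "s = t"
proof -
  have "s = r (inv v) (r v s)" by (rule act_inv[OF assms(1-3), symmetric])
  also have "\<dots> = t" unfolding assms(5) by (rule act_inv[OF assms(1,2,4)])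
  finally show ?thesis .
qed

text \<open>The factor h moves the base point to q, z multiplies there, and the inverse of h
  returns.\<close>

lemma act_conj:
  assumes act: "right_action G (A \<times> E) r" and h: "h \<in> carrier G" and z: "z \<in> carrier G"
    and q: "q \<in> E" "q0 \<in> E" and rh: "\<And>g. g \<in> A \<Longrightarrow> r h (g, q0) = (g, q)"
    and rz: "r z (g, q) = (g', q)" and g: "g \<in> A" "g' \<in> A"
  shows "r (h \<otimes> z \<otimes> inv h) (g, q0) = (g', q0)"
proof -
  have s: "(g, q0) \<in> A \<times> E" "(g', q0) \<in> A \<times> E" using q g by auto
  have "r (h \<otimes> z \<otimes> inv h) (g, q0) = r (inv h) (r z (r h (g, q0)))"
    using h z s by (simp only: act_mult[OF act] m_closed inv_closed)
  also have "\<dots> = r (inv h) (r h (g', q0))" by (simp only: rh[OF g(1)] rz rh[OF g(2)])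
  also have "\<dots> = (g', q0)" by (rule act_inv[OF act h s(2)])
  finally show ?thesis .
qed

lemma poly_free_chain:
  assumes N: "H1 \<lhd> G" "H2 \<lhd> G" and le: "H1 \<subseteq> H2"
    and fr: "free_group ((G\<lparr>carrier := H1\<rparr>) Mod {\<one>})" "free_group ((G\<lparr>carrier := H2\<rparr>) Mod H1)"
      "free_group ((G\<lparr>carrier := carrier G\<rparr>) Mod H2)"
  shows "poly_free G"
proof -
  define H where "H i = (if i = 0 then {\<one>} else if i = 1 then H1 else if i = 2 then H2 else carrier G)"
    for i :: nat
  have sub: "subgroup H1 G" "subgroup H2 G" using N normal_imp_subgroup by auto
  have triv: "{\<one>} \<lhd> G" by (rule one_is_normal)
  have self: "subgroup (carrier G) G" by (rule subgroup_self)
  have 1: "{\<one>} \<subseteq> H1" using subgroup.one_closed[OF sub(1)] by simp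
  have 2: "H2 \<subseteq> carrier G" by (rule subgroup.subset[OF sub(2)])
  have *: "subgroup (H i) G \<and> subgroup (H (Suc i)) G \<and> H i \<subseteq> H (Suc i) \<and>
      H i \<lhd> G\<lparr>carrier := H (Suc i)\<rparr> \<and> free_group ((G\<lparr>carrier := H (Suc i)\<rparr>) Mod H i)"
    if "i < 3" for i
  proof -
    have "i = 0 \<or> i = 1 \<or> i = 2" using that by linarith
    then consider "i = 0" | "i = 1" | "i = 2" by blast
    then show ?thesis
    proof cases
      case 1
      then show ?thesis using sub triv fr(1) normal_imp_subgroup[OF triv] \<open>{\<one>} \<subseteq> H1\<close>
          normal_restrict_supergroup[OF sub(1) triv] by (simp add: H_def)
    next
      case 2
      then show ?thesis using sub fr(2) le normal_restrict_supergroup[OF sub(2) N(1) le]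
        by (simp add: H_def)
    next
      case 3
      then show ?thesis using sub self fr(3) \<open>H2 \<subseteq> carrier G\<close>
          normal_restrict_supergroup[OF self N(2)] by (simp add: H_def)
    qed
  qed
  show ?thesis unfolding poly_free_def
    by (intro conjI is_group exI[of _ "3 :: nat"] exI[of _ H]) (use * in \<open>auto simp: H_def\<close>)
qed

section \<open>Freeness of the three successive quotients\<close>

context
  fixes x y z :: 'a
  assumes xyz: "x \<in> carrier G" "y \<in> carrier G" "z \<in> carrier G"
    and gens: "carrier G = generate G {x, y, z}"
begin

text \<open>The quotient is generated by the image of x, with one free letter. The action on a
  single point has the whole group as kernel, so \<open>free_level\<close> applies.\<close>

lemma free_top:
  fixes r' :: "'a \<Rightarrow> (((unit \<times> bool) list \<Rightarrow> (unit \<times> bool) list) \<times> unit) \<Rightarrow> _"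
  defines "B \<equiv> BijGroup (UNIV :: (unit \<times> bool) list set)"
  assumes K: "K \<lhd> G" "y \<in> K" "z \<in> K"
    and act': "right_action G (carrier B \<times> UNIV) r'" and K': "K \<subseteq> kernel_on G (carrier B \<times> UNIV) r'"
    and rx: "\<And>f. f \<in> carrier B \<Longrightarrow> r' x (f, ()) = (f \<otimes>\<^bsub>B\<^esub> push ((), True), ())"
  shows "free_group ((G\<lparr>carrier := carrier G\<rparr>) Mod K)"
proof -
  have ker: "kernel_on G (UNIV :: unit set) (\<lambda>_ s. s) = carrier G" by (simp add: kernel_on_def)
  have KG: "K \<subseteq> carrier G" using normal_imp_subgroup[OF K(1)] subgroup.subset by blast
  have act: "right_action G (UNIV :: unit set) (\<lambda>_ s. s)" by (simp add: right_action_def)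
  have xG: "{x} \<subseteq> carrier G" using xyz by simp
  show ?thesis
  proof (rule free_level[where K = K and E = "UNIV :: unit set" and r = "\<lambda>_ s. s" and S = "{x, y, z}"
        and w = "\<lambda>_. \<one>" and D = "\<lambda>_. x" and I = "UNIV :: unit set" and pt = "()"
        and E' = UNIV and r' = r' and qt = "()", unfolded ker, folded B_def,
        OF K(1) act KG gens _ _ _ _ _ _ act' _ K'])
    show "\<one> \<otimes> v \<otimes> inv \<one> \<in> K <#> generate G (range (\<lambda>_ :: unit. x))" if v: "v \<in> {x, y, z}" for v
    proof -
      have "v \<in> K <#> generate G {x}"
        using v K(2,3) subset_set_mult_generate[OF K(1) xG] generate.incl[of x "{x}" G] by blast
      then show ?thesis using v xyz by (auto simp: UNIV_unit)
    qed
    show "r' x (g, ()) = (g \<otimes>\<^bsub>B\<^esub> push (i, True), ())" if "g \<in> carrier B" for i g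
      using rx[OF that] by simp
  qed (use xyz in auto)
qed

text \<open>The conjugates of y by powers of x form a single line; the k entries at 0, ..., k - 1
  are the generators, and \<open>line_val\<close> sends them to distinct letters.\<close>

lemma free_middle:
  fixes r' :: "'a \<Rightarrow> (((int \<times> bool) list \<Rightarrow> (int \<times> bool) list) \<times> int) \<Rightarrow> _" and r2 :: "'a \<Rightarrow> int \<Rightarrow> int"
  defines "B \<equiv> BijGroup (UNIV :: (int \<times> bool) list set)"
  assumes k: "k \<ge> 1" and rel: "(x \<otimes> y) [^] (k::nat) = (y \<otimes> x) [^] k"
    and K: "K \<lhd> G" "z \<in> K"
    and act: "right_action G UNIV r2" and KE: "K \<subseteq> kernel_on G UNIV r2"
    and r2: "\<And>i. r2 x i = i + 1" "\<And>i. r2 y i = i" "\<And>i. r2 z i = i"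
    and act': "right_action G (carrier B \<times> UNIV) r'" and K': "K \<subseteq> kernel_on G (carrier B \<times> UNIV) r'"
    and rx: "\<And>f i. f \<in> carrier B \<Longrightarrow> r' x (f, i) = (f, i + 1)"
    and ry: "\<And>f i. f \<in> carrier B \<Longrightarrow>
       r' y (f, i) = (f \<otimes>\<^bsub>B\<^esub> line_val B k (\<lambda>j. push (int j, True)) i, i)"
  shows "free_group ((G\<lparr>carrier := kernel_on G UNIV r2\<rparr>) Mod K)"
proof -
  interpret B: group B unfolding B_def by (rule group_BijGroup)
  let ?w = "\<lambda>i::int. x [^] i" and ?I = "{0..<int k}"
  let ?D = "\<lambda>i. ?w i \<otimes> y \<otimes> inv (?w i)"
  have push: "push l \<in> carrier B" for l unfolding B_def by (rule push_Bij)
  have step: "?w (i + 1) = ?w i \<otimes> x" for i using int_pow_mult[of x i 1] xyz by simp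
  have Dc: "?D i \<in> carrier G" for i using xyz by simp
  have line: "is_line G k ?D" by (rule conj_is_line[of ?w, OF _ step xyz(1,2) rel]) (simp add: xyz)
  have Dgen: "?D i \<in> generate G (?D ` ?I)" for i
    by (rule is_line_subgroup[OF line k generate_is_subgroup]) (use Dc in \<open>auto intro: generate.incl\<close>)
  have DG: "?D ` ?I \<subseteq> carrier G" using Dc by blast
  have wr: "r' (?w i) (g, 0) = (g, i)" if g: "g \<in> carrier B" for g i
  proof (induction i rule: int_induct[where k = 0])
    case base
    then show ?case using act_one[OF act'] g by simp
  next
    case (step1 i)
    then show ?case using act_mult[OF act', of "?w i" x "(g, 0)"] step rx g xyz by simp
  next
    case (step2 i)
    have "r' x (r' (?w (i - 1)) (g, 0)) = r' x (g, i - 1)"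
      using act_mult[OF act', of "?w (i - 1)" x "(g, 0)"] step[of "i - 1"] step2 rx g xyz by simp
    then show ?case
      using act_inj[OF act' xyz(1)] act_in[OF act', of "?w (i - 1)" "(g, 0)"] g xyz by simp
  qed
  show ?thesis
  proof (rule free_level[where S = "{x, y, z}" and w = ?w and D = ?D and I = ?I and pt = 0
        and E' = UNIV and r' = r' and qt = 0, folded B_def, OF K(1) act KE gens _ _ _ _ _ _ act' _ K'])
    have "y \<in> kernel_on G UNIV r2" using xyz r2 by (simp add: kernel_on_def)
    then show "?D ` ?I \<subseteq> kernel_on G UNIV r2"
      using normal_conj[OF kernel_normal[OF act]] xyz by auto
    show "?w p \<otimes> v \<otimes> inv (?w (r2 v p)) \<in> K <#> generate G (?D ` ?I)" if v: "v \<in> {x, y, z}" for v p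
    proof -
      consider "v = x" | "v = y" | "v = z" using v by blast
      then show ?thesis
      proof cases
        case 1
        then show ?thesis using r2(1) step[symmetric] xyz subset_set_mult_generate(2)[OF K(1) DG generate.one]
          by simp
      next
        case 2
        then show ?thesis using r2(2) subset_set_mult_generate(2)[OF K(1) DG Dgen] by simp
      next
        case 3
        then show ?thesis
          using r2(3) subset_set_mult_generate(1)[OF K(1) DG normal_conj[OF K(1) _ K(2)]] xyz by simp
      qed
    qed
    show "r' (?D i) (g, 0) = (g \<otimes>\<^bsub>B\<^esub> push (i, True), 0)" if i: "i \<in> ?I" and g: "g \<in> carrier B" for i g
    proof (rule act_conj[OF act' _ xyz(2) _ _ wr _ g])
      have "line_val B k (\<lambda>j. push (int j, True)) i = push (i, True)"
        using B.line_val_base[of "nat i" k "\<lambda>j. push (int j, True)"] push i by (simp add: nat_less_iff)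
      then show "r' y (g, i) = (g \<otimes>\<^bsub>B\<^esub> push (i, True), i)" using ry g by simp
    qed (use g push xyz in auto)
  qed (use xyz in auto)
qed

text \<open>The element read along a path carries the root to the end of the path; steps backwards
  use that generators act injectively.\<close>

lemma node_elt_acts:
  fixes k :: nat
  defines "M \<equiv> 2 * int k"
  assumes rel: "(x \<otimes> y) [^] (k::nat) = (y \<otimes> x) [^] k"
    and act': "right_action G (A \<times> points M) r'"
    and rx: "\<And>f p. f \<in> A \<Longrightarrow> p \<in> points M \<Longrightarrow> r' x (f, p) = (f, tau M p)"
    and ry: "\<And>f p. f \<in> A \<Longrightarrow> p \<in> points M \<Longrightarrow> r' y (f, p) = (f, btau M p)"
    and g: "g \<in> A" and u: "u \<in> nodes M"
  shows "r' (node_elt G x y u) (g, ([], 0)) = (g, if evn u then u else toggle M u)"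
proof -
  let ?e = "\<lambda>u. if evn u then u else toggle M u"
  let ?w = "node_elt G x y" and ?s = "(g, ([], 0) :: node)"
  have e: "?e u \<in> points M" if "u \<in> nodes M" for u
    using that toggle_in evn_toggle by (auto simp: points_def)
  have s: "?s \<in> A \<times> points M" using g by (simp add: points_def nodes_def evn_def)
  have w: "?w u \<in> carrier G" for u using node_elt_closed[OF xyz(1,2) rel] .
  let ?v = "\<lambda>u. if evn u then x else y"
  have move: "r' (?v (rs, j)) (g, ?e (rs, j)) = (g, ?e (rs, j + 1))" if "(rs, j) \<in> nodes M" for rs j
  proof (cases "evn (rs, j)")
    case True
    then have "\<not> evn (rs, j + 1)" by (simp add: evn_def)
    then show ?thesis using True rx[of g "(rs, j)"] e[OF that] g by (simp add: tau_def)
  next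
    case False
    then have "evn (rs, j + 1)" by (simp add: evn_def)
    then show ?thesis using False ry[of g "toggle M (rs, j)"] e[OF that] g
        toggle_toggle[OF that] by (simp add: btau_def)
  qed
  have step: "r' (?w (rs, j + 1)) ?s = r' (?v (rs, j)) (r' (?w (rs, j)) ?s)" for rs j
    using act_mult[OF act' w _ s] xyz by (simp add: node_elt_Suc[OF xyz(1,2) rel])
  show ?thesis
  proof (rule node_induct[OF u, where P = "\<lambda>u. r' (?w u) ?s = (g, ?e u)"])
    show "r' (?w ([], 0)) ?s = (g, ?e ([], 0))"
      using act_one[OF act' s] by (simp add: node_elt_Nil[OF xyz(1,2) rel] evn_def)
  next
    fix rs j assume "(rs, j) \<in> nodes M" "r' (?w (rs, j)) ?s = (g, ?e (rs, j))"
    then show "r' (?w (rs, j + 1)) ?s = (g, ?e (rs, j + 1))" using move step by simp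
  next
    fix rs j assume n: "(rs, j) \<in> nodes M" and IH: "r' (?w (rs, j + 1)) ?s = (g, ?e (rs, j + 1))"
    have eq: "r' (?v (rs, j)) (r' (?w (rs, j)) ?s) = r' (?v (rs, j)) (g, ?e (rs, j))"
      using IH step move[OF n] by simp
    have v: "?v (rs, j) \<in> carrier G" using xyz by simp
    have ge: "(g, ?e (rs, j)) \<in> A \<times> points M" using g e[OF n] by blast
    show "r' (?w (rs, j)) ?s = (g, ?e (rs, j))"
      by (rule act_inj[OF act' v act_in[OF act' w s] ge eq])
  next
    fix u assume "u \<in> nodes M" "r' (?w u) ?s = (g, ?e u)"
    then show "r' (?w (toggle M u)) ?s = (g, ?e (toggle M u))"
      using node_elt_toggle[OF xyz(1,2) rel] by (simp add: evn_toggle toggle_toggle M_def)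
  qed
qed

text \<open>With the path elements as transversal the Schreier elements of x and y vanish and those
  of z are the conjugates \<open>node_conj\<close>. At the root, the conjugate for i acts as z does
  at the vertex i.\<close>

lemma free_bottom:
  fixes k :: nat and r' :: "'a \<Rightarrow> (((node \<times> bool) list \<Rightarrow> (node \<times> bool) list) \<times> node) \<Rightarrow> _"
  defines "M \<equiv> 2 * int k" and "B \<equiv> BijGroup (UNIV :: (node \<times> bool) list set)"
  assumes rel: "(x \<otimes> y) [^] (k::nat) = (y \<otimes> x) [^] k"
    and act: "right_action G (points M) r1"
    and r1: "\<And>p. p \<in> points M \<Longrightarrow> r1 x p = tau M p" "\<And>p. p \<in> points M \<Longrightarrow> r1 y p = btau M p"
      "\<And>p. p \<in> points M \<Longrightarrow> r1 z p = p"
    and I: "I \<subseteq> points M" and D: "\<And>u. u \<in> points M \<Longrightarrow> node_conj G x y z u \<in> generate G (node_conj G x y z ` I)"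
    and act': "right_action G (carrier B \<times> points M) r'"
    and rx: "\<And>f p. f \<in> carrier B \<Longrightarrow> p \<in> points M \<Longrightarrow> r' x (f, p) = (f, tau M p)"
    and ry: "\<And>f p. f \<in> carrier B \<Longrightarrow> p \<in> points M \<Longrightarrow> r' y (f, p) = (f, btau M p)"
    and rz: "\<And>f p. f \<in> carrier B \<Longrightarrow> p \<in> I \<Longrightarrow> r' z (f, p) = (f \<otimes>\<^bsub>B\<^esub> push (p, True), p)"
  shows "free_group ((G\<lparr>carrier := kernel_on G (points M) r1\<rparr>) Mod {\<one>})"
proof -
  interpret B: group B unfolding B_def by (rule group_BijGroup)
  let ?w = "node_elt G x y" and ?p0 = "([], 0) :: node"
  have push: "push l \<in> carrier B" for l unfolding B_def by (rule push_Bij)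
  have w: "?w u \<in> carrier G" for u using node_elt_closed[OF xyz(1,2) rel] .
  have DG: "node_conj G x y z ` I \<subseteq> carrier G" using w xyz by (auto simp: node_conj_def)
  have p0: "?p0 \<in> points M" by (simp add: points_def nodes_def evn_def)
  have triv: "{\<one>} \<lhd> G" by (rule one_is_normal)
  note mem = subset_set_mult_generate(2)[OF triv DG]
  show ?thesis
  proof (rule free_level[where S = "{x, y, z}" and w = ?w and D = "node_conj G x y z" and I = I and pt = ?p0
        and E' = "points M" and r' = r' and qt = ?p0, folded B_def,
        OF triv act _ gens _ w p0 _ _ _ act' p0])
    show "{\<one>} \<subseteq> kernel_on G (points M) r1"
      using subgroup.one_closed[OF kernel_subgroup[OF act]] by simp
    show "{\<one>} \<subseteq> kernel_on G (carrier B \<times> points M) r'"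
      using subgroup.one_closed[OF kernel_subgroup[OF act']] by simp
    show "?w ?p0 = \<one>" by (rule node_elt_Nil[OF xyz(1,2) rel])
    have "z \<in> kernel_on G (points M) r1" using xyz r1 by (simp add: kernel_on_def)
    then show "node_conj G x y z ` I \<subseteq> kernel_on G (points M) r1"
      using normal_conj[OF kernel_normal[OF act] w] by (auto simp: node_conj_def)
    show "?w p \<otimes> v \<otimes> inv (?w (r1 v p)) \<in> {\<one>} <#> generate G (node_conj G x y z ` I)"
      if v: "v \<in> {x, y, z}" and p: "p \<in> points M" for v p
    proof -
      have ev: "evn p" "\<not> evn (toggle M p)" using p by (simp_all add: points_def evn_toggle)
      consider "v = x" | "v = y" | "v = z" using v by blast
      then show ?thesis
      proof cases
        case 1
        then show ?thesis using r1(1)[OF p] node_elt_tau[OF xyz(1,2) rel, of p] ev w[of p] xyz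
            mem[OF generate.one] by (simp add: M_def)
      next
        case 2
        then show ?thesis using r1(2)[OF p] node_elt_btau[OF xyz(1,2) rel, of p] ev w[of p] xyz
            mem[OF generate.one] by (simp add: M_def)
      next
        case 3
        then show ?thesis using r1(3)[OF p] mem[OF D[OF p]] by (simp add: node_conj_def)
      qed
    qed
    show "r' (node_conj G x y z i) (g, ?p0) = (g \<otimes>\<^bsub>B\<^esub> push (i, True), ?p0)" if i: "i \<in> I" and g: "g \<in> carrier B" for i g
      unfolding node_conj_def
    proof (rule act_conj[OF act' w xyz(3) _ p0 _ rz[OF g i] g])
      show ip: "i \<in> points M" using i I by blast
      show "r' (?w i) (g, ?p0) = (g, i)" if "g \<in> carrier B" for g
        using node_elt_acts[OF rel, of "carrier B" r' g i, folded M_def, OF act' rx ry that] ip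
        by (simp add: points_def)
    qed (use g push in auto)
  qed (use xyz in auto)
qed

end

end

section \<open>The triangle\<close>

text \<open>The common interface of the two cases for the bottom layer: the conjugates over I
  generate, and C extends distinct letters on I to a solution of the equations of all a-lines and
  b-lines.\<close>

definition solves :: "('a, 'b) monoid_scheme \<Rightarrow> 'a \<Rightarrow> 'a \<Rightarrow> 'a \<Rightarrow> nat \<Rightarrow> nat \<Rightarrow> nat \<Rightarrow>
    node set \<Rightarrow> (node \<Rightarrow> ((node \<times> bool) list \<Rightarrow> (node \<times> bool) list)) \<Rightarrow> bool" where
  "solves G x y z k n l I C \<longleftrightarrow> I \<subseteq> points (2 * int k) \<and>
     (\<forall>u \<in> points (2 * int k). node_conj G x y z u \<in> generate G (node_conj G x y z ` I)) \<and>
     (\<forall>u \<in> points (2 * int k). C u \<in> carrier (BijGroup UNIV)) \<and>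
     (\<forall>u \<in> I. C u = push (u, True)) \<and>
     (\<forall>u \<in> points (2 * int k).
        lprod (BijGroup UNIV) (\<lambda>j. C ((tau (2 * int k) ^^ j) u)) n =
        lprod (BijGroup UNIV) (\<lambda>j. C ((tau (2 * int k) ^^ Suc j) u)) n) \<and>
     (\<forall>u \<in> points (2 * int k).
        lprod (BijGroup UNIV) (\<lambda>j. C ((btau (2 * int k) ^^ j) u)) l =
        lprod (BijGroup UNIV) (\<lambda>j. C ((btau (2 * int k) ^^ Suc j) u)) l)"

context group
begin

context
  fixes x y z :: 'a and k n l :: nat
  assumes xyz: "x \<in> carrier G" "y \<in> carrier G" "z \<in> carrier G"
    and rel_xy: "(x \<otimes> y) [^] k = (y \<otimes> x) [^] k"
    and rel_xz: "(x \<otimes> z) [^] n = (z \<otimes> x) [^] n"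
    and rel_yz: "(y \<otimes> z) [^] l = (z \<otimes> y) [^] l"
begin

lemma node_conj_toggle: "node_conj G x y z (toggle (2 * int k) u) = node_conj G x y z u"
  by (simp add: node_conj_def node_elt_toggle[OF xyz(1,2) rel_xy])

lemma node_conj_closed: "node_conj G x y z u \<in> carrier G"
  using xyz node_elt_closed[OF xyz(1,2) rel_xy] by (simp add: node_conj_def)

lemma solves_windows:
  assumes "k \<ge> 2" "n \<ge> 1" "l \<ge> 2"
  shows "\<exists>I C. solves G x y z k n l I C"
proof -
  let ?M = "2 * int k" and ?B = "BijGroup (UNIV :: (node \<times> bool) list set)"
  interpret W: windows "nodes ?M" "toggle ?M" "orb ?M" "pos ?M" "rank n l" "height ?M n l"
    using assms by (intro windows_nodes) auto
  have B: "group ?B" by (rule group_BijGroup)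
  let ?I = "{u \<in> points ?M. W.free u}"
  \<comment> \<open>Both descriptions of a vertex receive the letter of the even one, as
    \<open>ext\<close> requires.\<close>
  let ?f = "\<lambda>u. push (if evn u then u else toggle ?M u, True)"
  have f: "?f u \<in> carrier ?B" for u by (rule push_Bij)
  have f_flip: "?f (toggle ?M u) = ?f u" if "u \<in> nodes ?M" for u
    using that by (simp add: evn_toggle toggle_toggle)
  define C where "C = W.ext ?B ?f"
  have C: "C u \<in> carrier ?B" "C (toggle ?M u) = C u" "is_line ?B (rank n l u) (\<lambda>i. C (orb ?M u i))"
    if "u \<in> nodes ?M" for u
    unfolding C_def using W.ext_closed[where f = ?f, OF B f f_flip that]
      W.ext_flip[where f = ?f, OF B f f_flip that] W.ext_line[where f = ?f, OF B f f_flip that] by simp_all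
  have line: "lprod ?B (\<lambda>j. C ((tau ?M ^^ j) u)) (rank n l u) =
      lprod ?B (\<lambda>j. C ((tau ?M ^^ Suc j) u)) (rank n l u)" if "u \<in> nodes ?M" for u
  proof -
    have "lprod ?B (\<lambda>j. C (orb ?M u (0 + int j))) (rank n l u) =
      lprod ?B (\<lambda>j. C (orb ?M u (0 + 1 + int j))) (rank n l u)"
      using C(3)[OF that] unfolding is_line_def by blast
    moreover have "orb ?M u (0 + int j) = (tau ?M ^^ j) u"
      "orb ?M u (0 + 1 + int j) = (tau ?M ^^ Suc j) u" for j
      using zpow_of_nat[of "tau ?M" "tau' ?M" u] by (simp_all only: add_0 flip: of_nat_Suc)
    ultimately show ?thesis by (simp only:)
  qed
  \<comment> \<open>In the odd description a b-line is an orbit of \<open>tau\<close>, and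
    \<open>toggle\<close> carries its equation back.\<close>
  have bline: "lprod ?B (\<lambda>j. C ((btau ?M ^^ j) u)) l = lprod ?B (\<lambda>j. C ((btau ?M ^^ Suc j) u)) l"
    if u: "u \<in> points ?M" for u
  proof -
    let ?v = "toggle ?M u"
    have v: "?v \<in> nodes ?M" "rank n l ?v = l" "toggle ?M ?v = u"
      using u toggle_in toggle_toggle by (auto simp: points_def rank_def evn_toggle)
    have "C ((btau ?M ^^ j) u) = C ((tau ?M ^^ j) ?v)" for j
      using btau_funpow[OF v(1), of j] C(2)[OF tau_funpow_in[OF v(1), of j]] v(3) by simp
    then show ?thesis using line[OF v(1)] v(2) by (simp only:)
  qed
  have D: "node_conj G x y z u \<in> generate G (node_conj G x y z ` ?I)" if u: "u \<in> nodes ?M" for u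
  proof (rule W.free_generate[OF is_group generate_is_subgroup _ _ _ u])
    show "node_conj G x y z ` ?I \<subseteq> carrier G" using node_conj_closed by blast
    show "node_conj G x y z (toggle ?M u) = node_conj G x y z u" for u by (rule node_conj_toggle)
  next
    fix u assume u: "u \<in> nodes ?M"
    have step: "node_elt G x y (orb ?M u (i + 1)) =
        node_elt G x y (orb ?M u i) \<otimes> (if evn u then x else y)" for i
      using orb_plus_1[OF u, of i] node_elt_tau[OF xyz(1,2) rel_xy, of "orb ?M u i"] evn_orb[OF u] by simp
    show "is_line G (rank n l u) (\<lambda>i. node_conj G x y z (orb ?M u i))"
      unfolding node_conj_def
      by (rule conj_is_line[of "\<lambda>i. node_elt G x y (orb ?M u i)",
            OF node_elt_closed[OF xyz(1,2) rel_xy] step])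
        (use xyz rel_xz rel_yz in \<open>auto simp: rank_def\<close>)
  next
    fix u assume u: "u \<in> nodes ?M" "W.free u"
    then have "W.free (toggle ?M u)" using toggle_toggle[OF u(1)] by (auto simp: W.free_def)
    then have "u \<in> ?I \<or> toggle ?M u \<in> ?I" using u toggle_in by (auto simp: points_def evn_toggle)
    then show "node_conj G x y z u \<in> generate G (node_conj G x y z ` ?I)"
      using node_conj_toggle[of u] by (metis (no_types, lifting) generate.incl imageI)
  qed
  have C_free: "C u = push (u, True)" if "u \<in> ?I" for u
    using W.ext_free[where f = ?f, OF B f f_flip, of u] that by (simp add: C_def points_def)
  have aline: "lprod ?B (\<lambda>j. C ((tau ?M ^^ j) u)) n = lprod ?B (\<lambda>j. C ((tau ?M ^^ Suc j) u)) n"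
    if "u \<in> points ?M" for u
  proof -
    have "rank n l u = n" using that by (simp add: points_def rank_def)
    then show ?thesis using line[OF points_nodes[OF that]] by (simp only:)
  qed
  have "solves G x y z k n l ?I C"
    unfolding solves_def
  proof (intro conjI ballI)
    show "?I \<subseteq> points ?M" by blast
  qed (fact D[OF points_nodes] C(1)[OF points_nodes] C_free aline bline)+
  then show ?thesis by blast
qed

text \<open>Labels 2 make z commute with x and y, so the conjugates coincide along every edge and
  one generator at the root is left.\<close>

lemma solves_central:
  assumes nl: "n = 1" "l = 1"
  shows "\<exists>I C. solves G x y z k n l I C"
proof -
  let ?M = "2 * int k" and ?p = "([], 0) :: node"
  note w = node_elt_closed[OF xyz(1,2) rel_xy]
  have comm: "x \<otimes> z = z \<otimes> x" "y \<otimes> z = z \<otimes> y" using rel_xz rel_yz nl xyz by simp_all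
  have step: "node_conj G x y z (rs, j + 1) = node_conj G x y z (rs, j)" for rs j
  proof -
    let ?v = "if evn (rs, j) then x else y" and ?w = "node_elt G x y (rs, j)"
    have v: "?v \<in> carrier G" "?v \<otimes> z = z \<otimes> ?v" using xyz comm by auto
    have "node_conj G x y z (rs, j + 1) = ?w \<otimes> (?v \<otimes> z) \<otimes> inv (?w \<otimes> ?v)"
      using xyz v(1) w by (simp add: node_conj_def node_elt_Suc[OF xyz(1,2) rel_xy] m_assoc)
    also have "\<dots> = node_conj G x y z (rs, j)"
      unfolding v(2) using xyz v(1) w by (simp add: node_conj_def m_assoc inv_mult_group cancel_inv)
    finally show ?thesis .
  qed
  have D: "node_conj G x y z u = node_conj G x y z ?p" if "u \<in> nodes ?M" for u
    by (rule node_induct[OF that]) (simp_all add: step node_conj_toggle)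
  have "node_conj G x y z u \<in> generate G (node_conj G x y z ` {?p})" if "u \<in> points ?M" for u
    using D[of u] that by (auto simp: points_def intro: generate.incl)
  then have "solves G x y z k n l {?p} (\<lambda>_. push (?p, True))"
    unfolding solves_def by (auto simp: push_Bij nl points_def nodes_def evn_def)
  then show ?thesis by blast
qed

end

end

lemma triangle_action:
  fixes sa sb sc :: "'s \<Rightarrow> 's"
  assumes neq: "a \<noteq> b" "b \<noteq> c" "a \<noteq> c"
    and lab: "m {a, b} = 2 * k" "m {b, c} = 2 * l" "m {a, c} = 2 * n"
    and bij: "bij_betw sa \<Omega> \<Omega>" "bij_betw sb \<Omega> \<Omega>" "bij_betw sc \<Omega> \<Omega>"
    and ab: "\<And>s. s \<in> \<Omega> \<Longrightarrow> ((sb \<circ> sa) ^^ k) s = ((sa \<circ> sb) ^^ k) s"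
    and bc: "\<And>s. s \<in> \<Omega> \<Longrightarrow> ((sc \<circ> sb) ^^ l) s = ((sb \<circ> sc) ^^ l) s"
    and ac: "\<And>s. s \<in> \<Omega> \<Longrightarrow> ((sc \<circ> sa) ^^ n) s = ((sa \<circ> sc) ^^ n) s"
  shows "\<exists>r. right_action (artin_group {a, b, c} {{a, b}, {b, c}, {a, c}} m) \<Omega> r \<and>
    (\<forall>s \<in> \<Omega>. r (gen {a, b, c} {{a, b}, {b, c}, {a, c}} m a) s = sa s \<and>
      r (gen {a, b, c} {{a, b}, {b, c}, {a, c}} m b) s = sb s \<and>
      r (gen {a, b, c} {{a, b}, {b, c}, {a, c}} m c) s = sc s)"
proof -
  define f where "f v = (if v = a then sa else if v = b then sb else sc)" for v
  have f: "f a = sa" "f b = sb" "f c = sc" using neq by (auto simp: f_def)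
  have run: "fold (letter_act \<Omega> f) (alt_word u v (m {u, v})) s =
      fold (letter_act \<Omega> f) (alt_word v u (m {u, v})) s"
    if "{u, v} \<in> {{a, b}, {b, c}, {a, c}}" "s \<in> \<Omega>" for u v s
  proof -
    have "(u = a \<and> v = b) \<or> (u = b \<and> v = a) \<or> (u = b \<and> v = c) \<or> (u = c \<and> v = b) \<or>
        (u = a \<and> v = c) \<or> (u = c \<and> v = a)"
      using that(1) by (auto simp: doubleton_eq_iff)
    moreover have "m {b, a} = 2 * k" "m {c, b} = 2 * l" "m {c, a} = 2 * n"
      using lab by (simp_all add: insert_commute)
    ultimately show ?thesis
      using lab that(2) by (elim disjE conjE) (simp_all only: run_alt_word f ab bc ac)
  qed
  obtain r where "right_action (artin_group {a, b, c} {{a, b}, {b, c}, {a, c}} m) \<Omega> r"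
    "\<And>v s. v \<in> {a, b, c} \<Longrightarrow> s \<in> \<Omega> \<Longrightarrow> r (gen {a, b, c} {{a, b}, {b, c}, {a, c}} m v) s = f v s"
  proof (rule artin_action[where s = f and V = "{a, b, c}" and E = "{{a, b}, {b, c}, {a, c}}" and m = m and \<Omega> = \<Omega>])
    show "bij_betw (f v) \<Omega> \<Omega>" if "v \<in> {a, b, c}" for v using that bij f by auto
  qed (use run in blast)+
  then show ?thesis using f by (intro exI[of _ r]) simp
qed

lemma poly_free_triangle:
  fixes a b c :: 'v and m :: "'v set \<Rightarrow> nat"
  assumes neq: "a \<noteq> b" "b \<noteq> c" "a \<noteq> c"
    and lab: "m {a, b} = 2 * k" "m {b, c} = 2 * l" "m {a, c} = 2 * n"
    and cases: "k \<ge> 2 \<and> l \<ge> 2 \<and> n \<ge> 1 \<or> k \<ge> 1 \<and> l = 1 \<and> n = 1"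
  shows "poly_free (artin_group {a, b, c} {{a, b}, {b, c}, {a, c}} m)"
proof -
  let ?V = "{a, b, c}" and ?E = "{{a, b}, {b, c}, {a, c}}"
  define A where "A = artin_group ?V ?E m"
  interpret A: group A unfolding A_def by (rule group_artin)
  define x y z where xyz_def: "x = gen ?V ?E m a" "y = gen ?V ?E m b" "z = gen ?V ?E m c"
  have xyz: "x \<in> carrier A" "y \<in> carrier A" "z \<in> carrier A"
    unfolding A_def xyz_def by (simp_all add: gen_in)
  have gens: "carrier A = generate A {x, y, z}"
    unfolding A_def xyz_def using artin_generate[of ?V ?E m] by simp
  have rel_xy: "(x \<otimes>\<^bsub>A\<^esub> y) [^]\<^bsub>A\<^esub> k = (y \<otimes>\<^bsub>A\<^esub> x) [^]\<^bsub>A\<^esub> k"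
    unfolding A_def xyz_def using lab by (intro artin_relation) auto
  have rel_yz: "(y \<otimes>\<^bsub>A\<^esub> z) [^]\<^bsub>A\<^esub> l = (z \<otimes>\<^bsub>A\<^esub> y) [^]\<^bsub>A\<^esub> l"
    unfolding A_def xyz_def using lab by (intro artin_relation) auto
  have rel_xz: "(x \<otimes>\<^bsub>A\<^esub> z) [^]\<^bsub>A\<^esub> n = (z \<otimes>\<^bsub>A\<^esub> x) [^]\<^bsub>A\<^esub> n"
    unfolding A_def xyz_def using lab by (intro artin_relation) auto
  note action = triangle_action[OF neq lab, folded A_def xyz_def]
  have k1: "k \<ge> 1" using cases by auto
  let ?M = "2 * int k"
  let ?B1 = "BijGroup (UNIV :: (node \<times> bool) list set)"
  let ?B2 = "BijGroup (UNIV :: (int \<times> bool) list set)"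
  let ?B3 = "BijGroup (UNIV :: (unit \<times> bool) list set)"
  interpret B1: group ?B1 by (rule group_BijGroup)
  interpret B2: group ?B2 by (rule group_BijGroup)
  interpret B3: group ?B3 by (rule group_BijGroup)

  obtain I C where "solves A x y z k n l I C"
    using cases A.solves_windows[OF xyz rel_xy rel_xz rel_yz] A.solves_central[OF xyz rel_xy rel_xz rel_yz]
    by blast
  note sol = this[unfolded solves_def]
  have C: "C u \<in> carrier ?B1" if "u \<in> points ?M" for u using sol that by blast

  have bij_succ: "bij (\<lambda>i::int. i + 1)" by (rule bij_betwI[where g = "\<lambda>i. i - 1"]) auto
  obtain r1 where act1: "right_action A (points ?M) r1"
    and r1: "\<forall>p \<in> points ?M. r1 x p = tau ?M p \<and> r1 y p = btau ?M p \<and> r1 z p = id p"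
    using action[OF bij_tau bij_btau bij_betw_id points_relation] by auto
  obtain r2 where act2: "right_action A (UNIV :: int set) r2"
    and r2: "\<forall>i \<in> UNIV. r2 x i = i + 1 \<and> r2 y i = id i \<and> r2 z i = id i"
    using action[OF bij_succ bij_betw_id bij_betw_id] by auto
  let ?C = "\<lambda>(f, p). (f \<otimes>\<^bsub>?B1\<^esub> C p, p)"
  have "\<exists>r. right_action A (carrier ?B1 \<times> points ?M) r \<and> (\<forall>s \<in> carrier ?B1 \<times> points ?M.
      r x s = (\<lambda>(f, p). (f, tau ?M p)) s \<and> r y s = (\<lambda>(f, p). (f, btau ?M p)) s \<and> r z s = ?C s)"
  proof (rule action[OF bij_betw_snd[OF bij_tau] bij_betw_snd[OF bij_btau]])
    show "bij_betw ?C (carrier ?B1 \<times> points ?M) (carrier ?B1 \<times> points ?M)"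
      by (rule bij_betw_cocycle[OF group_BijGroup C])
    fix s :: "(((node \<times> bool) list \<Rightarrow> (node \<times> bool) list) \<times> node)"
    assume s: "s \<in> carrier ?B1 \<times> points ?M"
    then obtain f p where fp: "s = (f, p)" "f \<in> carrier ?B1" "p \<in> points ?M" by auto
    have lift: "(((\<lambda>(f, p). (f, t p)) \<circ> (\<lambda>(f, p). (f, t' p))) ^^ i) (f, p) = (f, ((t \<circ> t') ^^ i) p)"
      for t t' :: "node \<Rightarrow> node" and i by (induction i) auto
    show "(((\<lambda>(f, p). (f, btau ?M p)) \<circ> (\<lambda>(f, p). (f, tau ?M p))) ^^ k) s =
        (((\<lambda>(f, p). (f, tau ?M p)) \<circ> (\<lambda>(f, p). (f, btau ?M p))) ^^ k) s"
      unfolding fp(1) lift using points_relation[OF fp(3)] by simp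
    show "((?C \<circ> (\<lambda>(f, p). (f, btau ?M p))) ^^ l) s = (((\<lambda>(f, p). (f, btau ?M p)) \<circ> ?C) ^^ l) s"
      unfolding fp(1)
      by (rule cocycle_relation[of ?B1 "points ?M" "btau ?M" C])
        (use sol fp(2,3) btau_points group_BijGroup in blast)+
    show "((?C \<circ> (\<lambda>(f, p). (f, tau ?M p))) ^^ n) s = (((\<lambda>(f, p). (f, tau ?M p)) \<circ> ?C) ^^ n) s"
      unfolding fp(1)
      by (rule cocycle_relation[of ?B1 "points ?M" "tau ?M" C])
        (use sol fp(2,3) tau_points group_BijGroup in blast)+
  qed
  then obtain r1' where act1': "right_action A (carrier ?B1 \<times> points ?M) r1'"
    and r1': "\<forall>s \<in> carrier ?B1 \<times> points ?M. r1' x s = (\<lambda>(f, p). (f, tau ?M p)) s \<and>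
      r1' y s = (\<lambda>(f, p). (f, btau ?M p)) s \<and> r1' z s = ?C s"
    by blast
  let ?L = "line_val ?B2 k (\<lambda>j. push (int j, True))"
  have L: "is_line ?B2 k ?L" by (rule B2.line_val_is_line[OF k1]) (rule push_Bij)
  then have Lc: "?L i \<in> carrier ?B2" for i by (simp add: is_line_def)
  let ?C2 = "\<lambda>(f, i). (f \<otimes>\<^bsub>?B2\<^esub> ?L i, i)"
  have "\<exists>r. right_action A (carrier ?B2 \<times> UNIV) r \<and> (\<forall>s \<in> carrier ?B2 \<times> UNIV.
      r x s = (\<lambda>(f, i). (f, i + 1)) s \<and> r y s = ?C2 s \<and> r z s = id s)"
  proof (rule action[OF bij_betw_snd[OF bij_succ] bij_betw_cocycle[OF group_BijGroup Lc] bij_betw_id])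
    fix s :: "(((int \<times> bool) list \<Rightarrow> (int \<times> bool) list) \<times> int)"
    assume "s \<in> carrier ?B2 \<times> UNIV"
    then obtain f i where fi: "s = (f, i)" "f \<in> carrier ?B2" by auto
    have pow: "((\<lambda>i. i + 1) ^^ j) i = i + int j" for j by (induction j) auto
    have "lprod ?B2 (\<lambda>j. ?L (i + int j)) k = lprod ?B2 (\<lambda>j. ?L (i + 1 + int j)) k"
      using L unfolding is_line_def by blast
    then have line: "lprod ?B2 (\<lambda>j. ?L (((\<lambda>i. i + 1) ^^ j) i)) k =
        lprod ?B2 (\<lambda>j. ?L (((\<lambda>i. i + 1) ^^ Suc j) i)) k"
      unfolding pow by (simp add: ac_simps)
    show "((?C2 \<circ> (\<lambda>(f, i). (f, i + 1))) ^^ k) s = (((\<lambda>(f, i). (f, i + 1)) \<circ> ?C2) ^^ k) s"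
      unfolding fi(1)
      by (rule cocycle_relation[of ?B2 UNIV "\<lambda>i. i + 1" ?L, OF group_BijGroup _ Lc fi(2) _ line]) auto
  qed simp_all
  then obtain r2' where act2': "right_action A (carrier ?B2 \<times> UNIV) r2'"
    and r2': "\<forall>s \<in> carrier ?B2 \<times> UNIV. r2' x s = (\<lambda>(f, i). (f, i + 1)) s \<and> r2' y s = ?C2 s \<and> r2' z s = id s"
    by blast
  obtain r3' where act3': "right_action A (carrier ?B3 \<times> (UNIV :: unit set)) r3'"
    and r3': "\<forall>s \<in> carrier ?B3 \<times> UNIV. r3' x s = (\<lambda>(f, p). (f \<otimes>\<^bsub>?B3\<^esub> push ((), True), p)) s \<and>
      r3' y s = id s \<and> r3' z s = id s"
    using action[OF bij_betw_cocycle[OF group_BijGroup push_Bij] bij_betw_id bij_betw_id, of "UNIV :: unit set" "\<lambda>_. ((), True)"]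
    by auto

  let ?H1 = "kernel_on A (points ?M) r1" and ?H2 = "kernel_on A UNIV r2"
  have N: "?H1 \<lhd> A" "?H2 \<lhd> A" using A.kernel_normal act1 act2 by auto
  have zH1: "z \<in> ?H1" using r1 xyz by (simp add: kernel_on_def)
  have yzH2: "y \<in> ?H2" "z \<in> ?H2" using r2 xyz by (simp_all add: kernel_on_def)
  have S: "{x, y, z} \<subseteq> carrier A" using xyz by simp
  \<comment> \<open>\<open>?H1\<close> is the normal closure of z: the Schreier elements of x and y
    are trivial, those of z are conjugates of z. Hence it acts trivially wherever z does.\<close>
  have H1_le: "?H1 \<subseteq> N" if N: "N \<lhd> A" "z \<in> N" for N
  proof (rule A.kernel_subset[OF act1 normal_imp_subgroup[OF N(1)] gens S A.node_elt_closed[OF xyz(1,2) rel_xy]])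
    show "([], 0) \<in> points ?M" by (simp add: points_def nodes_def evn_def)
    show "node_elt A x y ([], 0) = \<one>\<^bsub>A\<^esub>" by (rule A.node_elt_Nil[OF xyz(1,2) rel_xy])
    note w = A.node_elt_closed[OF xyz(1,2) rel_xy]
    fix v p assume v: "v \<in> {x, y, z}" and p: "p \<in> points ?M"
    have ev: "evn p" "\<not> evn (toggle ?M p)" using p by (simp_all add: points_def evn_toggle)
    have one: "\<one>\<^bsub>A\<^esub> \<in> N" by (rule subgroup.one_closed[OF normal_imp_subgroup[OF N(1)]])
    from v consider "v = x" | "v = y" | "v = z" by blast
    then show "node_elt A x y p \<otimes>\<^bsub>A\<^esub> v \<otimes>\<^bsub>A\<^esub> inv\<^bsub>A\<^esub> (node_elt A x y (r1 v p)) \<in> N"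
    proof cases
      case 1
      then show ?thesis using r1 p A.node_elt_tau[OF xyz(1,2) rel_xy, of p] ev w[of p] xyz one
        by simp
    next
      case 2
      then show ?thesis using r1 p A.node_elt_btau[OF xyz(1,2) rel_xy, of p] ev w[of p] xyz one
        by simp
    next
      case 3
      then show ?thesis using r1 p A.normal_conj[OF N(1) w N(2)] by simp
    qed
  qed
  \<comment> \<open>Likewise \<open>?H2\<close> is the normal closure of y and z, with the powers of
    x as transversal.\<close>
  have H2_le: "?H2 \<subseteq> N" if N: "N \<lhd> A" "y \<in> N" "z \<in> N" for N
  proof (rule A.kernel_subset[OF act2 normal_imp_subgroup[OF N(1)] gens S, where w = "\<lambda>i. x [^]\<^bsub>A\<^esub> i" and pt = 0])
    fix v and i :: int assume v: "v \<in> {x, y, z}"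
    have step: "x [^]\<^bsub>A\<^esub> (i + 1) = x [^]\<^bsub>A\<^esub> i \<otimes>\<^bsub>A\<^esub> x" using A.int_pow_mult[OF xyz(1), of i 1] xyz by simp
    have one: "\<one>\<^bsub>A\<^esub> \<in> N" by (rule subgroup.one_closed[OF normal_imp_subgroup[OF N(1)]])
    have conj: "x [^]\<^bsub>A\<^esub> i \<otimes>\<^bsub>A\<^esub> h \<otimes>\<^bsub>A\<^esub> inv\<^bsub>A\<^esub> (x [^]\<^bsub>A\<^esub> i) \<in> N" if "h \<in> N" for h
      using A.normal_conj[OF N(1) _ that] xyz by simp
    from v consider "v = x" | "v = y" | "v = z" by blast
    then show "x [^]\<^bsub>A\<^esub> i \<otimes>\<^bsub>A\<^esub> v \<otimes>\<^bsub>A\<^esub> inv\<^bsub>A\<^esub> (x [^]\<^bsub>A\<^esub> r2 v i) \<in> N"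
    proof cases
      case 1
      then show ?thesis using r2 step one xyz by simp
    qed (use conj N r2 in auto)
  qed (use xyz in auto)

  show ?thesis unfolding A_def[symmetric]
  proof (rule A.poly_free_chain[OF N H1_le[OF N(2) yzH2(2)]])
    show "free_group ((A\<lparr>carrier := ?H1\<rparr>) Mod {\<one>\<^bsub>A\<^esub>})"
      by (rule A.free_bottom[OF xyz gens rel_xy act1, where I = I and r' = r1'])
        (use sol r1 r1' act1' in auto)
    have "z \<in> kernel_on A (carrier ?B2 \<times> UNIV) r2'" using r2' xyz by (simp add: kernel_on_def)
    then have K2: "?H1 \<subseteq> kernel_on A (carrier ?B2 \<times> UNIV) r2'"
      by (rule H1_le[OF A.kernel_normal[OF act2']])
    show "free_group ((A\<lparr>carrier := ?H2\<rparr>) Mod ?H1)"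
      by (rule A.free_middle[OF xyz gens k1 rel_xy N(1) zH1 act2 H1_le[OF N(2) yzH2(2)] _ _ _ act2' K2])
        (use r2 r2' in auto)
    have "y \<in> kernel_on A (carrier ?B3 \<times> UNIV) r3'" "z \<in> kernel_on A (carrier ?B3 \<times> UNIV) r3'"
      using r3' xyz by (simp_all add: kernel_on_def)
    then have K3: "?H2 \<subseteq> kernel_on A (carrier ?B3 \<times> UNIV) r3'"
      by (rule H2_le[OF A.kernel_normal[OF act3']])
    show "free_group ((A\<lparr>carrier := carrier A\<rparr>) Mod ?H2)"
      by (rule A.free_top[OF xyz gens N(2) yzH2 act3' K3]) (use r3' in auto)
  qed
qed

theorem theoremB:
  fixes a b c :: 'v and m :: "'v set \<Rightarrow> nat"
  assumes "a \<noteq> b" and "b \<noteq> c" and "a \<noteq> c"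
    and "\<forall>e \<in> {{a, b}, {b, c}, {a, c}}. even (m e) \<and> m e \<ge> 2"
  shows "poly_free (artin_group {a, b, c} {{a, b}, {b, c}, {a, c}} m)"
proof -
  obtain k l n where lab: "m {a, b} = 2 * k" "m {b, c} = 2 * l" "m {a, c} = 2 * n"
    using assms(4) by (auto elim!: evenE)
  have pos: "k \<ge> 1" "l \<ge> 1" "n \<ge> 1" using assms(4) lab by auto
  have lab': "m {b, a} = 2 * k" "m {c, b} = 2 * l" "m {c, a} = 2 * n"
    using lab by (simp_all add: insert_commute)
  have V: "{b, c, a} = {a, b, c}" "{c, a, b} = {a, b, c}" "{b, a, c} = {a, b, c}" "{a, c, b} = {a, b, c}"
    by auto
  have E: "{{b, c}, {c, a}, {b, a}} = {{a, b}, {b, c}, {a, c}}"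
    "{{c, a}, {a, b}, {c, b}} = {{a, b}, {b, c}, {a, c}}"
    "{{b, a}, {a, c}, {b, c}} = {{a, b}, {b, c}, {a, c}}"
    by (auto simp: insert_commute)
  \<comment> \<open>Of three even labels two exceed 2 or two equal 2. A rotation brings the common
    vertex of two such edges to the second place in the first case, to the third place in the
    other.\<close>
  consider "k \<ge> 2 \<and> l \<ge> 2 \<or> l = 1 \<and> n = 1" | "l \<ge> 2 \<and> n \<ge> 2 \<or> k = 1 \<and> n = 1"
    | "n \<ge> 2 \<and> k \<ge> 2 \<or> k = 1 \<and> l = 1"
    using pos by linarith
  then show ?thesis
  proof cases
    case 1
    then show ?thesis using poly_free_triangle[of a b c m k l n] assms lab pos by auto
  next
    case 2
    then show ?thesis
      using poly_free_triangle[of b c a m l n k] assms lab lab' pos unfolding V E by auto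
  next
    case 3
    then show ?thesis
      using poly_free_triangle[of c a b m n k l] assms lab lab' pos unfolding V E by auto
  qed
qed

end
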